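(* Let $m,n\ge 2$ and $r\ge 0$ be integers. Let $X$ and $Y$ be positive words of length $r$, and let $Y^{(h)}$ be a positive word of length $h\in\{0,\dots,r\}$. All equalities below are equalities in the monoid $G_{m,n}^{+}$. (i) If $vX=vY$ for some $v\in L_0$, then $X=Y$. (ii) If $t_iX=u_jY$ for some $t_i\in L_1$, $u_j\in L_2$, then $X=u_jZ$ and $Y=t_iZ$ for some positive word $Z$. (iii) If $sX=w(\underline t)\,Y^{(h)}$ for some positive word $w(\underline t)\in F_1^{+}$ of length $r-h+1$, then $X=\Delta_{1,s}\cdot \mathrm R(w(\underline t))\cdot Z$ and $Y^{(h)}=\Delta_{1,\mathrm C(w(\underline t))}\cdot Z$ for some positive word $Z$. (iv) If $sX=w(\underline u)\,Y^{(h)}$ for some positive word $w(\underline u)\in F_2^{+}$ of length $r-h+1$, then $X=\Delta_{2,s}\cdot \mathrm R(w(\underline u))\cdot Z$ and $Y^{(h)}=\Delta_{2,\mathrm C(w(\underline u))}\cdot Z$ for some positive word $Z$. (v) If $t_iX=w(\underline t)\,Y^{(h)}$ for some $t_i\in L_1$ and some positive word $w(\underline t)\in F_1^{+}$ of length $r-h+1$ that is not left-divisible by $t_i$, then there exists $w(\underline u)\in F^{+}_{2,\mathrm{rm}}$ such that $X=w(\underline u)\cdot\Delta_{1,t_i}\cdot \mathrm R(w(\underline t))\cdot Z$ and $Y^{(h)}=w(\underline u)\cdot\Delta_{1,\mathrm C(w(\underline t))}\cdot Z$ for some positive word $Z$. (vi) If $u_iX=w(\underline u)\,Y^{(h)}$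 for some $u_i\in L_2$ and some positive word $w(\underline u)\in F_2^{+}$ of length $r-h+1$ that is not left-divisible by $u_i$, then there exists $w(\underline t)\in F^{+}_{1,\mathrm{rm}}$ such that $X=w(\underline t)\cdot\Delta_{2,u_i}\cdot \mathrm R(w(\underline u))\cdot Z$ and $Y^{(h)}=w(\underline t)\cdot\Delta_{2,\mathrm C(w(\underline u))}\cdot Z$ for some positive word $Z$.
   Context: For letters $x_1,\dots,x_k$, the symbol $[x_1,x_2,\dots,x_k]$ denotes the cyclic relations $x_1x_2\cdots x_k=x_2\cdots x_kx_1=x_3\cdots x_kx_1x_2=\cdots=x_kx_1\cdots x_{k-1}$ (all cyclic rotations of the word are equal); in particular $[x,y]$ denotes $xy=yx$. $G_{m,n}^{+}$ is the monoid presented (as a monoid) by the generators $s,t_1,\dots,t_m,u_1,\dots,u_n$ and the relations $[s,t_1,\dots,t_m]$, $[s,u_1,\dots,u_n]$, and $[t_i,u_j]$ for all $1\le i\le m$, $1\le j\le n$. All relations preserve length. A positive word is a (possibly empty) word in the generators, viewed as an element of $G_{m,n}^{+}$. Notation: $L_0=\{s,t_1,\dots,t_m,u_1,\dots,u_n\}$, $L_1=\{t_1,\dots,t_m\}$, $L_2=\{u_1,\dots,u_n\}$. $F_1^{+}$ and $F_2^{+}$ are the free monoids on $L_1$ and $L_2$; their elements are written $w(\underline t)$ and $w(\underline u)$. In each of these free monoids, $U$ left-divides (right-divides) $V$ if $V=UW$ ($V=WU$) for some $W$, i.e. $U$ is a prefix (suffix) of $V$. $F^{+}_{1,\mathrm{rm}}$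 is the set of $w\in F_1^{+}$ that are not right-divisible by $t_1t_2\cdots t_m$; $F^{+}_{2,\mathrm{rm}}$ is the set of $w\in F_2^{+}$ that are not right-divisible by $u_1u_2\cdots u_n$. For a nonempty word $w\in F_1^{+}$, $\mathrm C(w)$ denotes the longest suffix of $w$ of the form $t_{a}t_{a+1}\cdots t_{b}$ with $1\le a\le b\le m$ (consecutive increasing indices), and $\mathrm R(w)\in F_1^{+}$ is defined by the word identity $w\equiv \mathrm R(w)\,\mathrm C(w)$. For a nonempty word $w\in F_2^{+}$, $\mathrm C(w)$ and $\mathrm R(w)$ are defined in the same way with $u_a u_{a+1}\cdots u_b$, $1\le a\le b\le n$. Put $\Delta_1=s\,t_1\cdots t_m$ and $\Delta_2=s\,u_1\cdots u_n$. For $w=t_a t_{a+1}\cdots t_b$ ($1\le a\le b\le m$), $\Delta_{1,w}:=t_{b+1}\cdots t_m\,s\,t_1\cdots t_{a-1}$, so that $\Delta_1=w\,\Delta_{1,w}=\Delta_{1,w}\,w$ in $G_{m,n}^{+}$; in particular $\Delta_{1,t_i}=t_{i+1}\cdots t_m\,s\,t_1\cdots t_{i-1}$. Also $\Delta_{1,s}:=t_1\cdots t_m$. Likewise, for $w=u_a\cdots u_b$ ($1\le a\le b\le n$), $\Delta_{2,w}:=u_{b+1}\cdots u_n\,s\,u_1\cdots u_{a-1}$, and $\Delta_{2,s}:=u_1\cdots u_n$. *)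

theory Defs
  imports Main "HOL-Library.Sublist"
begin

text \<open>
  Elements of a presented monoid are represented by words (lists) over the alphabet \<open>A\<close>;
  equality in the monoid is the least congruence on \<open>lists A\<close> containing the relations \<open>R\<close>.
\<close>

inductive pres_eq :: "'a set \<Rightarrow> ('a list \<times> 'a list) set \<Rightarrow> 'a list \<Rightarrow> 'a list \<Rightarrow> bool"
  for A :: "'a set" and R :: "('a list \<times> 'a list) set"
where
  rel: "\<lbrakk>(p, q) \<in> R; p \<in> lists A; q \<in> lists A; x \<in> lists A; y \<in> lists A\<rbrakk>
          \<Longrightarrow> pres_eq A R (x @ p @ y) (x @ q @ y)"
| refl: "x \<in> lists A \<Longrightarrow> pres_eq A R x x"
| sym: "pres_eq A R x y \<Longrightarrow> pres_eq A R y x"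
| trans: "\<lbrakk>pres_eq A R x y; pres_eq A R y z\<rbrakk> \<Longrightarrow> pres_eq A R x z"

definition cyclic_rels :: "'a list \<Rightarrow> ('a list \<times> 'a list) set" where
  "cyclic_rels w = {(w, rotate k w) | k. True}"

datatype gen = S | T nat | U nat

definition L1 :: "nat \<Rightarrow> gen set" where
  "L1 m = T ` {1..m}"

definition L2 :: "nat \<Rightarrow> gen set" where
  "L2 n = U ` {1..n}"

definition L0 :: "nat \<Rightarrow> nat \<Rightarrow> gen set" where
  "L0 m n = {S} \<union> L1 m \<union> L2 n"

text \<open>
  In the following, a constructor \<open>c\<close> (\<open>T\<close> or \<open>U\<close>) together with the number \<open>k\<close> of letters of
  that kind (\<open>m\<close> or \<open>n\<close>) selects one of the two families.  \<open>run c a b\<close> is the word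
  \<open>c a, c (a + 1), \<dots>, c b\<close>, which is empty if \<open>b < a\<close>.
\<close>

definition run :: "(nat \<Rightarrow> gen) \<Rightarrow> nat \<Rightarrow> nat \<Rightarrow> gen list" where
  "run c a b = map c [a..<Suc b]"

definition G_rels :: "nat \<Rightarrow> nat \<Rightarrow> (gen list \<times> gen list) set" where
  "G_rels m n = cyclic_rels (S # run T 1 m) \<union> cyclic_rels (S # run U 1 n)
     \<union> (\<Union>i\<in>{1..m}. \<Union>j\<in>{1..n}. cyclic_rels [T i, U j])"

definition G_eq :: "nat \<Rightarrow> nat \<Rightarrow> gen list \<Rightarrow> gen list \<Rightarrow> bool" where
  "G_eq m n = pres_eq (L0 m n) (G_rels m n)"

definition F1_rm :: "nat \<Rightarrow> gen list set" where
  "F1_rm m = {w \<in> lists (L1 m). \<not> suffix (run T 1 m) w}"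

definition F2_rm :: "nat \<Rightarrow> gen list set" where
  "F2_rm n = {w \<in> lists (L2 n). \<not> suffix (run U 1 n) w}"

text \<open>
  \<open>CC\<close> and \<open>RR\<close> are only meaningful for nonempty words in the letters \<open>c 1, \<dots>, c k\<close>.
\<close>

definition CC :: "(nat \<Rightarrow> gen) \<Rightarrow> nat \<Rightarrow> gen list \<Rightarrow> gen list" where
  "CC c k w = (ARG_MAX length v.
     suffix v w \<and> (\<exists>a b. 1 \<le> a \<and> a \<le> b \<and> b \<le> k \<and> v = run c a b))"

definition RR :: "(nat \<Rightarrow> gen) \<Rightarrow> nat \<Rightarrow> gen list \<Rightarrow> gen list" where
  "RR c k w = (THE v. w = v @ CC c k w)"

text \<open>
  \<open>Delta c k w\<close> is \<open>\<Delta>\<^sub>1\<^sub>,\<^sub>w\<close> for \<open>c = T\<close>, \<open>k = m\<close> and \<open>\<Delta>\<^sub>2\<^sub>,\<^sub>w\<close> for \<open>c = U\<close>, \<open>k = n\<close>.  It is only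
  meaningful for \<open>w = [S]\<close> and for \<open>w = run c a b\<close> with \<open>1 \<le> a \<le> b \<le> k\<close>; in the latter case
  \<open>w\<close> determines \<open>a\<close> and \<open>b\<close>.
\<close>

definition Delta :: "(nat \<Rightarrow> gen) \<Rightarrow> nat \<Rightarrow> gen list \<Rightarrow> gen list" where
  "Delta c k w = (if w = [S] then run c 1 k else
     (THE d. \<exists>a b. 1 \<le> a \<and> a \<le> b \<and> b \<le> k \<and> w = run c a b \<and>
        d = run c (b + 1) k @ [S] @ run c 1 (a - 1)))"

end

theory Submission
  imports Defs
begin

text \<open>
  Let \<open>head_rel\<close> be the relation between words that lists the possible shapes of \<open>v X = v' Y\<close> for
  single letters \<open>v\<close>, \<open>v'\<close>.  It contains the defining relations and is symmetric, so it contains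
  equality on words of length \<open>N + 1\<close> as soon as it is transitive there, and transitivity is shown
  assuming that it contains equality on words of length at most \<open>N\<close>.

  The delicate case \<open>t\<^sub>i X = t\<^sub>g Y = t\<^sub>j W\<close> compares two factors \<open>x\<close>, \<open>x'\<close> in the \<open>u\<^sub>j\<close> with
  \<open>x s P = x' s P'\<close>.  If \<open>x\<close> and \<open>x'\<close> differ, then both sides are left multiples of
  \<open>\<Delta>\<^sub>2 = s u\<^sub>1 \<cdots> u\<^sub>n\<close> because \<open>x = x\<^sub>0 u\<^sub>e \<cdots> u\<^sub>n\<close> and \<open>P = u\<^sub>1 \<cdots> u\<^sub>e\<^sub>-\<^sub>1 P\<^sub>1\<close>, and since \<open>\<Delta>\<^sub>2\<close>
  commutes with \<open>x\<^sub>0\<close> the factor \<open>x\<close> can be moved to the right of the critical block.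

  For longer words \<open>w\<close> the form \<open>w Y = x t\<^sub>e \<cdots> t\<^sub>m s Q\<close> is preserved, with \<open>e = f + 1\<close>, when a first
  letter \<open>t\<^sub>f\<close> is stripped from \<open>w\<close>; when only the final run \<open>C(w)\<close> is left, \<open>t\<^sub>e\<close> is not its first letter
  because \<open>C(w)\<close> is maximal, which forces the block \<open>\<Delta>\<^sub>1\<^sub>,\<^sub>C\<^sub>(\<^sub>w\<^sub>)\<close>.
\<close>

declare One_nat_def [simp del]

section \<open>Runs of consecutive letters\<close>

definition lo :: "(nat \<Rightarrow> gen) \<Rightarrow> nat \<Rightarrow> gen list" where
  "lo c a = run c 1 (a - 1)"

text \<open>
  The full run \<open>c 1 \<cdots> c k\<close> is written \<open>lo c (Suc k)\<close>; \<open>Dl c k a b\<close> is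
  \<open>\<Delta>\<^sub>1\<^sub>,\<^sub>w\<close> (or \<open>\<Delta>\<^sub>2\<^sub>,\<^sub>w\<close>) for \<open>w = run c a b\<close>.
\<close>

abbreviation Dl :: "(nat \<Rightarrow> gen) \<Rightarrow> nat \<Rightarrow> nat \<Rightarrow> nat \<Rightarrow> gen list" where
  "Dl c k a b \<equiv> run c (Suc b) k @ S # lo c a"

lemma run_Cons: "a \<le> b \<Longrightarrow> run c a b = c a # run c (Suc a) b"
  unfolding run_def by (subst upt_conv_Cons) simp_all

lemma run_Nil [simp]: "b < a \<Longrightarrow> run c a b = []"
  by (simp add: run_def)

lemma lo_1 [simp]: "lo c 1 = []"
  by (simp add: lo_def)

lemma length_run [simp]: "length (run c a b) = Suc b - a"
  by (simp add: run_def del: upt_Suc)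

lemma length_lo [simp]: "length (lo c a) = a - 1"
  by (simp add: lo_def)

lemma run_append: "a \<le> Suc b \<Longrightarrow> b \<le> e \<Longrightarrow> run c a b @ run c (Suc b) e = run c a e"
  unfolding run_def map_append[symmetric]
  by (metis Suc_le_mono le_Suc_ex upt_add_eq_append)

lemma lo_Suc: "1 \<le> a \<Longrightarrow> lo c (Suc a) = lo c a @ [c a]"
  by (cases a) (simp_all add: lo_def run_def)

lemma lo_run: "1 \<le> a \<Longrightarrow> a \<le> Suc k \<Longrightarrow> lo c a @ run c a k = lo c (Suc k)"
  using run_append[of 1 "a - 1" k c] by (cases a) (simp_all add: lo_def)

lemma run_in_lists: "1 \<le> a \<Longrightarrow> b \<le> k \<Longrightarrow> run c a b \<in> lists (c ` {1..k})"
  by (auto simp: run_def)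

lemma lo_in_lists: "a \<le> Suc k \<Longrightarrow> lo c a \<in> lists (c ` {1..k})"
  unfolding lo_def by (rule run_in_lists) auto

section \<open>Two fans of letters sharing \<open>s\<close>\<close>

text \<open>
  Exchanging the two families is a symmetry (\<open>flip\<close>).  Equality is taken on all words over \<open>gen\<close>, also
  with letters whose index is out of range; these satisfy no relation, and no membership side conditions
  on words arise.
\<close>

locale fan =
  fixes eq :: "gen list \<Rightarrow> gen list \<Rightarrow> bool" (infix "\<approx>" 50)
    and c d :: "nat \<Rightarrow> gen" and k l :: nat
  assumes eq_refl [simp, intro]: "x \<approx> x"
    and eq_sym: "x \<approx> y \<Longrightarrow> y \<approx> x"
    and eq_trans [trans]: "x \<approx> y \<Longrightarrow> y \<approx> z \<Longrightarrow> x \<approx> z"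
    and eq_cong: "x \<approx> y \<Longrightarrow> p @ x @ q \<approx> p @ y @ q"
    and eq_length: "x \<approx> y \<Longrightarrow> length x = length y"
    and rel_c: "1 \<le> i \<Longrightarrow> i \<le> k \<Longrightarrow> S # lo c (Suc k) \<approx> run c i k @ S # lo c i"
    and rel_d: "1 \<le> i \<Longrightarrow> i \<le> l \<Longrightarrow> S # lo d (Suc l) \<approx> run d i l @ S # lo d i"
    and rel_cd: "1 \<le> i \<Longrightarrow> i \<le> k \<Longrightarrow> 1 \<le> j \<Longrightarrow> j \<le> l \<Longrightarrow> [c i, d j] \<approx> [d j, c i]"
    and k2: "2 \<le> k" and l2: "2 \<le> l"
    and c_inj [simp]: "c i = c j \<longleftrightarrow> i = j"
    and d_inj [simp]: "d i = d j \<longleftrightarrow> i = j"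
    and cd_neq [simp]: "c i \<noteq> d j" "d j \<noteq> c i"
    and S_neq [simp]: "c i \<noteq> S" "S \<noteq> c i" "d i \<noteq> S" "S \<noteq> d i"
begin

lemma flip: "fan eq d c l k"
  by unfold_locales
    (auto simp: k2 l2 intro: eq_sym eq_trans eq_cong eq_length rel_c rel_d eq_sym[OF rel_cd])

abbreviation "CL \<equiv> lists (c ` {1..k})"
abbreviation "DL \<equiv> lists (d ` {1..l})"

text \<open>
  Words act on sets of words by left multiplication up to \<open>\<approx>\<close>.  Equal words have equal actions and
  conversely, so congruence reasoning becomes rewriting of \<open>act\<close> terms.
\<close>

definition lett :: "gen \<Rightarrow> gen list set \<Rightarrow> gen list set" where
  "lett v A = {z. \<exists>y\<in>A. z \<approx> v # y}"

primrec act :: "gen list \<Rightarrow> gen list set \<Rightarrow> gen list set" where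
  "act [] A = A"
| "act (v # x) A = lett v (act x A)"

lemma act_append [simp]: "act (x @ y) A = act x (act y A)"
  by (induction x) simp_all

lemma eq_Cons: "x \<approx> y \<Longrightarrow> v # x \<approx> v # y"
  using eq_cong[of x y "[v]" "[]"] by simp

text \<open>The empty word is excluded because \<open>act [] A\<close> is \<open>A\<close> itself,
  which need not be closed under \<open>\<approx>\<close>.\<close>

lemma act_char: "x \<noteq> [] \<Longrightarrow> act x A = {z. \<exists>y\<in>A. z \<approx> x @ y}"
proof (induction x)
  case (Cons v x)
  show ?case
  proof (cases "x = []")
    case True
    then show ?thesis by (simp add: lett_def)
  next
    case False
    then have "act (v # x) A = {z. \<exists>w y. y \<in> A \<and> w \<approx> x @ y \<and> z \<approx> v # w}"
      using Cons.IH by (auto simp: lett_def)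
    then show ?thesis
      by (auto intro: eq_trans[OF _ eq_Cons])
  qed
qed simp

lemma eqD: assumes "x \<approx> y" shows "act x A = act y A"
proof (cases "x = []")
  case True
  then show ?thesis using eq_length[OF assms] by simp
next
  case False
  then have "y \<noteq> []" using eq_length[OF assms] by auto
  moreover have "x @ q \<approx> y @ q" for q using eq_cong[OF assms, of "[]" q] by simp
  then have "z \<approx> x @ q \<longleftrightarrow> z \<approx> y @ q" for z q by (meson eq_trans eq_sym)
  ultimately show ?thesis using False by (simp add: act_char)
qed

text \<open>The action on \<open>{[]}\<close> already separates words: for nonempty
  \<open>x\<close>, \<open>act x {[]}\<close> is the class of \<open>x\<close>. Preservation of
  length settles the empty word.\<close>

lemma eqI: assumes "\<And>A. act x A = act y A" shows "x \<approx> y"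
proof (cases "x = []")
  case True
  have "y = []"
  proof (rule ccontr)
    assume "y \<noteq> []"
    then have "[] \<approx> y" using assms[of "{[]}"] True by (auto simp: act_char)
    then show False using eq_length \<open>y \<noteq> []\<close> by fastforce
  qed
  then show ?thesis using True by simp
next
  case False
  have ne: "y \<noteq> []"
  proof
    assume "y = []"
    then have "[] \<approx> x" using assms[of "{[]}"] False by (auto simp: act_char)
    then show False using eq_length False by fastforce
  qed
  have "x \<in> act x {[]}" using False by (simp add: act_char)
  then show ?thesis using assms[of "{[]}"] ne by (simp add: act_char)
qed

lemma act_comm:
  assumes "y \<in> CL" "x \<in> DL"
  shows "act y (act x A) = act x (act y A)"
proof -
  have 1: "lett (c i) (lett (d j) A) = lett (d j) (lett (c i) A)"
    if "i \<in> {1..k}" "j \<in> {1..l}" for i j A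
    using eqD[OF rel_cd[of i j], of A] that by simp
  have 2: "lett (c i) (act x A) = act x (lett (c i) A)" if "i \<in> {1..k}" for i A
    using assms(2) by (induction x) (auto simp: 1[OF that])
  show ?thesis using assms(1) by (induction y) (auto simp: 2)
qed

lemma act_comm1: "i \<in> {1..k} \<Longrightarrow> x \<in> DL \<Longrightarrow> lett (c i) (act x A) = act x (lett (c i) A)"
  using act_comm[of "[c i]" x A] by simp

text \<open>The relations \<open>rel_c\<close> equate all rotations of
  \<open>S # lo c (Suc k)\<close>; each is compared here with the rotation \<open>i = 1\<close>,
  which ends in \<open>S\<close>. The value \<open>i = Suc k\<close> is the unrotated word, with
  \<open>S\<close> in front.\<close>

lemma act_rotate:
  assumes "1 \<le> i" "i \<le> Suc k"
  shows "act (run c i k) (lett S (act (lo c i) A)) = act (lo c (Suc k)) (lett S A)"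
proof -
  have "act (run c i k) (lett S (act (lo c i) A)) = lett S (act (lo c (Suc k)) A)" if "1 \<le> i" "i \<le> Suc k" for i
    using eqD[OF rel_c[of i], of A] that by (cases "i = Suc k") simp_all
  from this[of i] this[of 1] assms show ?thesis
    using lo_run[of 1 k c] by simp
qed

lemma S_comm_lo: "lett S (act (lo c (Suc k)) A) = act (lo c (Suc k)) (lett S A)"
  using act_rotate[of "Suc k" A] k2 by simp

lemma letter_Dl:
  assumes "i \<in> {1..k}"
  shows "lett (c i) (act (run c (Suc i) k) (lett S (act (lo c i) A))) = act (lo c (Suc k)) (lett S A)"
  using act_rotate[of i A] assms by (simp add: run_Cons)

text \<open>Let \<Delta> be \<open>lo c (Suc k) @ [S]\<close> and D the block
  \<open>Dl c k i i\<close>. Rotations give \<Delta> = \<open>c i\<close> D = D \<open>c i\<close>,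
  hence \<open>c i\<close> \<Delta> = \<open>c i\<close> D \<open>c i\<close> = \<Delta>
  \<open>c i\<close>.\<close>

lemma full_central:
  assumes "y \<in> CL"
  shows "act y (act (lo c (Suc k)) (lett S A)) = act (lo c (Suc k)) (lett S (act y A))"
proof -
  have "lett (c i) (act (lo c (Suc k)) (lett S A)) = act (lo c (Suc k)) (lett S (lett (c i) A))"
    if i: "i \<in> {1..k}" for i A
  proof -
    have "act (run c (Suc i) k) (lett S (act (lo c i) (lett (c i) A))) = act (lo c (Suc k)) (lett S A)"
      using act_rotate[of "Suc i" A] i by (simp add: lo_Suc)
    then show ?thesis using letter_Dl[OF i, of "lett (c i) A"] by simp
  qed
  then show ?thesis using assms by (induction y) auto
qed

lemmas full_lo_in_lists = lo_in_lists[of "Suc k" k c, simplified]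

section \<open>Shapes of equal words with given first letters\<close>

text \<open>In \<open>head_cc\<close> and \<open>head_dd\<close> the factor \<open>x\<close> is any
  word of the other family, with no condition on its suffix. So letters can be prepended to it
  freely, as in \<open>head_trans_dcd\<close>; \<open>trim_full_suffix\<close> normalises it at the
  end.\<close>

inductive head_rel :: "gen list \<Rightarrow> gen list \<Rightarrow> bool" where
  head_Nil: "head_rel [] []"
| head_same: "X \<approx> Y \<Longrightarrow> head_rel (v # X) (v # Y)"
| head_cd: "i \<in> {1..k} \<Longrightarrow> j \<in> {1..l} \<Longrightarrow> X \<approx> d j # Z \<Longrightarrow> Y \<approx> c i # Z \<Longrightarrow> head_rel (c i # X) (d j # Y)"
| head_dc: "i \<in> {1..k} \<Longrightarrow> j \<in> {1..l} \<Longrightarrow> X \<approx> d j # Z \<Longrightarrow> Y \<approx> c i # Z \<Longrightarrow> head_rel (d j # Y) (c i # X)"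
| head_Sc: "i \<in> {1..k} \<Longrightarrow> X \<approx> lo c (Suc k) @ Z \<Longrightarrow> Y \<approx> Dl c k i i @ Z \<Longrightarrow> head_rel (S # X) (c i # Y)"
| head_cS: "i \<in> {1..k} \<Longrightarrow> X \<approx> lo c (Suc k) @ Z \<Longrightarrow> Y \<approx> Dl c k i i @ Z \<Longrightarrow> head_rel (c i # Y) (S # X)"
| head_Sd: "i \<in> {1..l} \<Longrightarrow> X \<approx> lo d (Suc l) @ Z \<Longrightarrow> Y \<approx> Dl d l i i @ Z \<Longrightarrow> head_rel (S # X) (d i # Y)"
| head_dS: "i \<in> {1..l} \<Longrightarrow> X \<approx> lo d (Suc l) @ Z \<Longrightarrow> Y \<approx> Dl d l i i @ Z \<Longrightarrow> head_rel (d i # Y) (S # X)"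
| head_cc: "i \<in> {1..k} \<Longrightarrow> j \<in> {1..k} \<Longrightarrow> i \<noteq> j \<Longrightarrow> x \<in> DL \<Longrightarrow>
     X \<approx> x @ Dl c k i i @ Z \<Longrightarrow> Y \<approx> x @ Dl c k j j @ Z \<Longrightarrow> head_rel (c i # X) (c j # Y)"
| head_dd: "i \<in> {1..l} \<Longrightarrow> j \<in> {1..l} \<Longrightarrow> i \<noteq> j \<Longrightarrow> x \<in> CL \<Longrightarrow>
     X \<approx> x @ Dl d l i i @ Z \<Longrightarrow> Y \<approx> x @ Dl d l j j @ Z \<Longrightarrow> head_rel (d i # X) (d j # Y)"

lemma head_sym: "head_rel a b \<Longrightarrow> head_rel b a"
  by (induction rule: head_rel.induct) (blast intro: head_rel.intros eq_sym)+

definition head_rel_upto :: "nat \<Rightarrow> bool" where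
  "head_rel_upto N \<longleftrightarrow> (\<forall>a b. a \<approx> b \<longrightarrow> length a \<le> N \<longrightarrow> head_rel a b)"

text \<open>The condition under which \<open>y s P\<close> is a left multiple of \<open>s c\<^sub>1 \<cdots> c\<^sub>k\<close>.\<close>

definition ends :: "gen list \<Rightarrow> gen list \<Rightarrow> bool" where
  "ends y P \<longleftrightarrow> (\<exists>e y0 P1. 1 \<le> e \<and> e \<le> Suc k \<and> y = y0 @ run c e k \<and> P \<approx> lo c e @ P1)"

sublocale flip: fan eq d c l k
  by (rule flip)

lemma head_flip: "flip.head_rel = head_rel"
proof -
  have "head_rel a b" if "flip.head_rel a b" for a b
    using that by (induction rule: flip.head_rel.induct) (rule head_rel.intros; assumption)+
  moreover have "flip.head_rel a b" if "head_rel a b" for a b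
    using that by (induction rule: head_rel.induct) (rule flip.head_rel.intros; assumption)+
  ultimately show ?thesis by blast
qed

lemma head_same_D: "head_rel (v # X) (v # Y) \<Longrightarrow> X \<approx> Y"
  by (erule head_rel.cases) auto

lemma head_cd_D: "head_rel (c i # X) (d j # Y) \<Longrightarrow> \<exists>Z. X \<approx> d j # Z \<and> Y \<approx> c i # Z"
  by (erule head_rel.cases) auto

lemma head_Sc_D: "head_rel (S # X) (c i # Y) \<Longrightarrow> \<exists>Z. X \<approx> lo c (Suc k) @ Z \<and> Y \<approx> Dl c k i i @ Z"
  by (erule head_rel.cases) auto

lemma head_cc_D: "head_rel (c i # X) (c j # Y) \<Longrightarrow> i \<noteq> j \<Longrightarrow>
    \<exists>x\<in>DL. \<exists>Z. X \<approx> x @ Dl c k i i @ Z \<and> Y \<approx> x @ Dl c k j j @ Z"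
  by (erule head_rel.cases) auto

lemma head_c_cases:
  assumes "head_rel (c g # Y) e"
  obtains W where "e = c g # W" "Y \<approx> W"
  | X Z where "g \<in> {1..k}" "e = S # X" "X \<approx> lo c (Suc k) @ Z" "Y \<approx> Dl c k g g @ Z"
  | j W x Z where "g \<in> {1..k}" "j \<in> {1..k}" "g \<noteq> j" "x \<in> DL" "e = c j # W" "Y \<approx> x @ Dl c k g g @ Z" "W \<approx> x @ Dl c k j j @ Z"
  | j W Z where "g \<in> {1..k}" "j \<in> {1..l}" "e = d j # W" "Y \<approx> d j # Z" "W \<approx> c g # Z"
  using assms by (cases rule: head_rel.cases) auto

lemma head_S_cases:
  assumes "head_rel (S # Y) e"
  obtains W where "e = S # W" "Y \<approx> W"
  | j W Z where "j \<in> {1..k}" "e = c j # W" "Y \<approx> lo c (Suc k) @ Z" "W \<approx> Dl c k j j @ Z"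
  | j W Z where "j \<in> {1..l}" "e = d j # W" "Y \<approx> lo d (Suc l) @ Z" "W \<approx> Dl d l j j @ Z"
  using assms by (cases rule: head_rel.cases) auto

lemma head_tail:
  assumes "head_rel (v # X) e" "X \<approx> Y" shows "head_rel (v # Y) e"
  using assms(1) by (cases rule: head_rel.cases) (blast intro: head_rel.intros eq_trans[OF eq_sym[OF assms(2)]])+

lemma head_rel_upto_flip: "flip.head_rel_upto = head_rel_upto"
  by (simp add: flip.head_rel_upto_def head_rel_upto_def fun_eq_iff head_flip)


lemma head_relI: "head_rel_upto N \<Longrightarrow> a \<approx> b \<Longrightarrow> length a \<le> N \<Longrightarrow> head_rel a b"
  by (simp add: head_rel_upto_def)

section \<open>Cancellation and common multiples of the two commuting families\<close>

lemma cancel_left: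
  assumes "head_rel_upto N" "p @ X \<approx> p @ Y" "length (p @ X) \<le> N"
  shows "X \<approx> Y"
  using assms(2,3)
proof (induction p rule: list.induct)
  case (Cons v p)
  then show ?case using head_same_D head_relI[OF assms(1)] by fastforce
qed simp

lemma comm_div1:
  assumes "head_rel_upto N" "y \<in> CL" "j \<in> {1..l}" "y @ X \<approx> d j # Y" "length (y @ X) \<le> N"
  shows "\<exists>Z. X \<approx> d j # Z \<and> Y \<approx> y @ Z"
  using assms(2,4,5)
proof (induction y arbitrary: Y rule: list.induct)
  case (Cons v y)
  then obtain i where v: "v = c i" "i \<in> {1..k}" and y: "y \<in> CL" by auto
  from Cons.prems obtain Z where Z: "y @ X \<approx> d j # Z" "Y \<approx> c i # Z"
    using head_cd_D[OF head_relI[OF assms(1), of "c i # y @ X" "d j # Y"]] v by auto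
  from Cons.IH[OF y Z(1)] Cons.prems(3) obtain Z' where Z': "X \<approx> d j # Z'" "Z \<approx> y @ Z'"
    by auto
  have "Y \<approx> (v # y) @ Z'"
    using eq_trans[OF Z(2) eq_Cons[OF Z'(2)]] v by simp
  with Z' show ?case by blast
qed auto

text \<open>The product \<open>y @ x\<close> is the least common right multiple of \<open>y\<close>
  and \<open>x\<close>: by \<open>comm_div1\<close> each letter of \<open>x\<close> passes through
  all of \<open>y\<close>.\<close>

lemma comm_div:
  assumes "head_rel_upto N" "y \<in> CL" "x \<in> DL" "y @ X \<approx> x @ Y" "length (y @ X) \<le> N"
  shows "\<exists>Z. X \<approx> x @ Z \<and> Y \<approx> y @ Z"
  using assms(3-5)
proof (induction x arbitrary: X Y rule: list.induct)
  case Nil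
  then show ?case by (auto intro: eq_sym)
next
  case (Cons v x)
  then obtain j where v: "v = d j" "j \<in> {1..l}" and x: "x \<in> DL" by auto
  from comm_div1[OF assms(1,2) v(2), of X "x @ Y"] Cons.prems v
  obtain Z where Z: "X \<approx> d j # Z" "x @ Y \<approx> y @ Z" by auto
  have "length (y @ Z) \<le> N" using eq_length[OF Z(1)] Cons.prems(3) by simp
  from Cons.IH[OF x eq_sym[OF Z(2)] this] obtain Z' where Z': "Z \<approx> x @ Z'" "Y \<approx> y @ Z'"
    by auto
  have "X \<approx> (v # x) @ Z'"
    using eq_trans[OF Z(1) eq_Cons[OF Z'(1)]] v by simp
  with Z' show ?case by blast
qed

section \<open>Words \<open>y @ S # P\<close> that begin with the full block\<close>

lemma endsE:
  assumes "ends y P" "y \<in> CL"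
  obtains e y0 P1 where "1 \<le> e" "e \<le> Suc k" "y = y0 @ run c e k" "P \<approx> lo c e @ P1" "y0 \<in> CL"
  using assms unfolding ends_def by (metis append_in_lists_conv)

lemma ends_S:
  assumes "1 \<le> e" "e \<le> Suc k" "y0 \<in> CL"
  shows "act y0 (act (run c e k) (lett S (act (lo c e) A))) = act (lo c (Suc k)) (lett S (act y0 A))"
  by (simp only: act_rotate[OF assms(1,2)] full_central[OF assms(3)])

lemma ends_mult:
  assumes "ends y P" "y \<in> CL"
  shows "\<exists>P2. y @ S # P \<approx> lo c (Suc k) @ S # P2"
proof -
  obtain e y0 P1 where e: "1 \<le> e" "e \<le> Suc k" "y = y0 @ run c e k" "P \<approx> lo c e @ P1" "y0 \<in> CL"
    using endsE[OF assms] .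
  have "y @ S # P \<approx> lo c (Suc k) @ S # y0 @ P1"
    by (rule eqI) (simp add: e(3) eqD[OF e(4)] ends_S e)
  then show ?thesis by blast
qed

lemma full_div:
  assumes "i \<in> {1..k}"
  shows "lo c (Suc k) @ S # P \<approx> c i # Dl c k i i @ P"
  by (rule eqI) (simp add: letter_Dl[OF assms])

lemma full_div':
  assumes "i \<in> {1..k}"
  shows "S # lo c (Suc k) @ P \<approx> c i # Dl c k i i @ P"
  by (rule eqI) (simp add: letter_Dl[OF assms] S_comm_lo)

lemma ends_div:
  assumes "ends y P" "y \<in> CL" "i \<in> {1..k}"
  shows "\<exists>V. y @ S # P \<approx> c i # V"
  using ends_mult[OF assms(1,2)] full_div[OF assms(3)] eq_trans by blast

text \<open>The final run is taken maximal, so that it is \<open>CC c k y\<close>: the letter before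
  it does not extend it. For \<open>a = 1\<close> this is automatic, since \<open>c 0\<close> does
  not occur in \<open>y\<close>.\<close>

lemma decompose:
  assumes "y \<in> CL" "y \<noteq> []"
  shows "\<exists>p a b. y = p @ run c a b \<and> 1 \<le> a \<and> a \<le> b \<and> b \<le> k \<and> p \<in> CL \<and> (p \<noteq> [] \<longrightarrow> last p \<noteq> c (a - 1))"
  using assms
proof (induction y rule: list.induct)
  case (Cons v y)
  then obtain f where f: "v = c f" "1 \<le> f" "f \<le> k" by auto
  show ?case
  proof (cases "y = []")
    case True
    then have "v # y = [] @ run c f f" using f by (simp add: run_Cons)
    then show ?thesis using f by blast
  next
    case False
    then obtain p a b where p: "y = p @ run c a b" "1 \<le> a" "a \<le> b" "b \<le> k" "p \<in> CL"
      "p \<noteq> [] \<longrightarrow> last p \<noteq> c (a - 1)"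
      using Cons by auto
    show ?thesis
    proof (cases "p = [] \<and> a = Suc f")
      case True
      then have "v # y = [] @ run c f b" using f p by (simp add: run_Cons[of f])
      then show ?thesis using f p True by (intro exI[of _ "[]"] exI[of _ f] exI[of _ b]) auto
    next
      case False
      then have "v # y = (v # p) @ run c a b" "last (v # p) \<noteq> c (a - 1)" "v # p \<in> CL"
        using f p by auto
      then show ?thesis using p by blast
    qed
  qed
qed simp

text \<open>Stripping \<open>c f\<close> keeps the shape, with \<open>e\<close> replaced by
  \<open>Suc f\<close>. For \<open>e \<le> k\<close> the factor \<open>x\<close> is moved behind
  \<open>run c e k\<close>, so that \<open>c f\<close> meets \<open>c e\<close>: equal letters
  cancel, different ones yield a whole block by \<open>head_cc\<close>. For \<open>e = Suc k\<close>
  the run is empty, and \<open>c f\<close> meets \<open>S\<close> once \<open>x\<close> has been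
  divided off.\<close>

lemma run_div_step:
  assumes g: "head_rel_upto N" and f: "f \<in> {1..k}" and x: "x \<in> DL" and e: "1 \<le> e" "e \<le> Suc k"
    and eq: "c f # W \<approx> x @ run c e k @ S # Q" and len: "length (c f # W) \<le> N"
  shows "\<exists>x'\<in>DL. \<exists>Q'. W \<approx> x' @ run c (Suc f) k @ S # Q' \<and> (e \<noteq> f \<longrightarrow> (\<exists>Z. Q' = lo c f @ Z))"
proof (cases "e = Suc k")
  case True
  then have "[c f] @ W \<approx> x @ S # Q" using eq by simp
  from comm_div[OF g _ x this] len f obtain W1 where W1: "W \<approx> x @ W1" "S # Q \<approx> c f # W1"
    by auto
  have "length (S # Q) \<le> N" using len eq_length[OF eq] by simp
  from head_Sc_D[OF head_relI[OF g W1(2) this]] obtain Z where Z: "W1 \<approx> Dl c k f f @ Z" by auto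
  have "W \<approx> x @ run c (Suc f) k @ S # lo c f @ Z"
    by (rule eqI) (simp add: eqD[OF W1(1)] eqD[OF Z])
  then show ?thesis using x by blast
next
  case False
  with e have e': "e \<in> {1..k}" by simp
  have eq': "c f # W \<approx> c e # run c (Suc e) k @ x @ S # Q"
  proof (rule eqI)
    fix A
    have "act (x @ run c e k @ S # Q) A = act (run c e k) (act x (lett S (act Q A)))"
      using act_comm[OF run_in_lists x, of e k] e by simp
    then show "act (c f # W) A = act (c e # run c (Suc e) k @ x @ S # Q) A"
      using e' eqD[OF eq, of A] by (simp add: run_Cons)
  qed
  have h: "head_rel (c f # W) (c e # run c (Suc e) k @ x @ S # Q)"
    using head_relI[OF g eq' len] .
  show ?thesis
  proof (cases "e = f")
    case True
    with h have "W \<approx> run c (Suc f) k @ x @ S # Q" using head_same_D by blast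
    moreover have "run c (Suc f) k @ x @ S # Q \<approx> x @ run c (Suc f) k @ S # Q"
      by (rule eqI) (simp add: act_comm[OF run_in_lists x])
    ultimately have "W \<approx> x @ run c (Suc f) k @ S # Q" by (rule eq_trans)
    then show ?thesis using x True by blast
  next
    case False
    with head_cc_D[OF h] obtain x' Z where "x' \<in> DL" "W \<approx> x' @ Dl c k f f @ Z" by auto
    then show ?thesis by auto
  qed
qed

lemma run_div:
  assumes g: "head_rel_upto N" and "p \<in> CL" and ab: "1 \<le> a" "a \<le> b" "b \<le> k"
    and "p = [] \<Longrightarrow> e \<noteq> a" "p \<noteq> [] \<longrightarrow> last p \<noteq> c (a - 1)"
    and "x \<in> DL" "1 \<le> e" "e \<le> Suc k"
    and "(p @ run c a b) @ Y \<approx> x @ run c e k @ S # Q" and "length ((p @ run c a b) @ Y) \<le> N"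
  shows "\<exists>x\<in>DL. \<exists>Z. Y \<approx> x @ Dl c k a b @ Z"
  using assms(2,6-)
proof (induction p arbitrary: x e Q rule: list.induct)
  case Nil
  have "c a # run c (Suc a) b @ Y \<approx> x @ run c e k @ S # Q"
    using Nil.prems(7) ab by (simp add: run_Cons)
  from run_div_step[OF g _ Nil.prems(4-6) this] Nil.prems(2,8) ab
  obtain x' Z where x': "x' \<in> DL" "run c (Suc a) b @ Y \<approx> x' @ run c (Suc a) k @ S # lo c a @ Z"
    by (auto simp: run_Cons[of a b])
  \<comment> \<open>The run up to \<open>k\<close> is split at \<open>b\<close> and its first part
    moved before \<open>x'\<close>, where it can be cancelled.\<close>
  have "run c (Suc a) b @ Y \<approx> run c (Suc a) b @ x' @ run c (Suc b) k @ S # lo c a @ Z"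
  proof (rule eqI)
    fix A
    have "run c (Suc a) k = run c (Suc a) b @ run c (Suc b) k"
      using run_append[of "Suc a" b k c] ab by simp
    then show "act (run c (Suc a) b @ Y) A = act (run c (Suc a) b @ x' @ run c (Suc b) k @ S # lo c a @ Z) A"
      using ab by (simp add: eqD[OF x'(2), simplified] act_comm[OF run_in_lists x'(1)])
  qed
  from cancel_left[OF g this] Nil.prems ab x'(1) show ?case by (auto simp: run_Cons[of a b])
next
  case (Cons v p)
  then obtain f where f: "v = c f" "f \<in> {1..k}" and p: "p \<in> CL" by auto
  have "c f # (p @ run c a b) @ Y \<approx> x @ run c e k @ S # Q"
    using Cons.prems(7) f by simp
  from run_div_step[OF g f(2) Cons.prems(4-6) this] Cons.prems f
  obtain x' Q' where x': "x' \<in> DL" "(p @ run c a b) @ Y \<approx> x' @ run c (Suc f) k @ S # Q'"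
    by auto
  \<comment> \<open>The next \<open>e\<close> is \<open>Suc f\<close>. If \<open>c f\<close> was the
    last letter of the prefix, maximality of the run says exactly
    \<open>Suc f \<noteq> a\<close>.\<close>
  have "p = [] \<Longrightarrow> Suc f \<noteq> a" "p \<noteq> [] \<longrightarrow> last p \<noteq> c (a - 1)"
    using Cons.prems(3) f ab by auto
  from Cons.IH[OF p this x'(1) _ _ x'(2)] f Cons.prems show ?case by auto
qed

text \<open>A word \<open>x\<close> of the other family has no influence on divisibility by
  \<open>lo c e\<close>: \<open>comm_div\<close> takes that prefix through \<open>x\<close> to
  \<open>Z\<close>.\<close>

lemma ends_cancel:
  assumes "head_rel_upto N" "x \<in> DL" "ends y (x @ Z)" "length (x @ Z) \<le> N"
  shows "ends y Z"
proof -
  obtain e y0 P1 where e: "1 \<le> e" "e \<le> Suc k" "y = y0 @ run c e k" "x @ Z \<approx> lo c e @ P1"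
    using assms(3) unfolding ends_def by blast
  have "length (lo c e @ P1) \<le> N" using eq_length[OF e(4)] assms(4) by simp
  from comm_div[OF assms(1) lo_in_lists[OF e(2)] assms(2) eq_sym[OF e(4)] this]
  show ?thesis using e unfolding ends_def by blast
qed

text \<open>A word that starts with \<open>c q\<close> and is divisible by all letters of its family
  is tested with a second letter: the alternative of starting with that letter fails, and
  \<open>ends\<close> remains.\<close>

lemma other_index: "\<exists>i\<in>{1..k}. i \<noteq> q"
proof (cases "q = 1")
  case True
  then show ?thesis using k2 by (intro bexI[of _ 2]) auto
next
  case False
  then show ?thesis using k2 by (intro bexI[of _ 1]) auto
qed

text \<open>\<open>flip\<close> provides the mirror images only of facts proved before the context is entered.\<close>

end

section \<open>Division of \<open>y @ S # P\<close> by a single letter\<close>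

context fan
begin

text \<open>As \<open>hd y\<close> and \<open>c j\<close> differ, \<open>head_cc\<close> supplies a
  block after \<open>c j\<close>; moving \<open>c j\<close> through \<open>x\<close> completes the
  run to \<open>run c j k\<close>. This is the shape from which \<open>run_div\<close>
  starts.\<close>

lemma c_div:
  assumes g: "head_rel_upto N" and y: "y \<in> CL" "y \<noteq> []" "hd y \<noteq> c j" and j: "j \<in> {1..k}"
    and eq: "y @ W \<approx> c j # V" and len: "length (y @ W) \<le> N"
  shows "\<exists>x\<in>DL. \<exists>Z. y @ W \<approx> x @ run c j k @ S # lo c j @ Z"
proof -
  obtain f y' where y': "y = c f # y'" "f \<noteq> j" using y by (cases y) auto
  from head_relI[OF g eq len] y' have "head_rel (c f # y' @ W) (c j # V)" by simp
  from head_cc_D[OF this y'(2)] obtain x Z where x: "x \<in> DL" "V \<approx> x @ Dl c k j j @ Z" by auto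
  have "y @ W \<approx> x @ run c j k @ S # lo c j @ Z"
  proof (rule eqI)
    fix A
    have "act (y @ W) A = lett (c j) (act (x @ Dl c k j j @ Z) A)"
      using eqD[OF eq, of A] eqD[OF x(2), of A] by simp
    also have "\<dots> = act (x @ run c j k @ S # lo c j @ Z) A"
      using act_comm1[OF j x(1)] j by (simp add: run_Cons)
    finally show "act (y @ W) A = act (x @ run c j k @ S # lo c j @ Z) A" .
  qed
  with x(1) show ?thesis by blast
qed

text \<open>Dividing off a nonempty \<open>y\<close> with final run \<open>run c a b\<close> leaves
  \<open>S # P0\<close> as \<open>x @ Dl c k a b @ Z\<close>. If \<open>b < k\<close>, the letter
  \<open>c (Suc b)\<close> passes \<open>x\<close> and divides \<open>S # P0\<close>, so
  \<open>P0\<close> begins with the full run. If \<open>b = k\<close>, the factor \<open>x\<close>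
  has to be moved out of the way, for which \<open>IH\<close> gives the mirror statement on a
  shorter word.\<close>

lemma div_step:
  assumes g: "head_rel_upto N"
    and IH: "\<And>x P j V. x \<in> DL \<Longrightarrow> j \<in> {1..l} \<Longrightarrow> x @ S # P \<approx> d j # V
        \<Longrightarrow> length (x @ S # P) < length (y @ S # P0) \<Longrightarrow> (\<exists>x1. x = d j # x1) \<or> flip.ends x P"
    and y: "y \<in> CL" and j: "j \<in> {1..k}" and eq: "y @ S # P0 \<approx> c j # V"
    and len: "length (y @ S # P0) \<le> N"
  shows "(\<exists>y1. y = c j # y1) \<or> ends y P0"
proof (cases "y = []")
  case True
  with head_relI[OF g eq len] have "head_rel (S # P0) (c j # V)" by simp
  from head_Sc_D[OF this] True show ?thesis
    unfolding ends_def by (force intro!: exI[of _ "Suc k"])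
next
  case False
  show ?thesis
  proof (cases "hd y = c j")
    case True
    with False show ?thesis by (cases y) auto
  next
    case hd: False
    from decompose[OF y False] obtain p a b where y_eq: "y = p @ run c a b"
      and ab: "1 \<le> a" "a \<le> b" "b \<le> k" and p: "p \<in> CL" "p \<noteq> [] \<longrightarrow> last p \<noteq> c (a - 1)"
      by auto
    have y': "length (S # P0) < N" using len False by (cases y) auto
    from c_div[OF g y False hd j eq len] obtain x Z where x: "x \<in> DL"
      and "y @ S # P0 \<approx> x @ run c j k @ S # lo c j @ Z" by blast
    then have eq2: "(p @ run c a b) @ S # P0 \<approx> x @ run c j k @ S # (lo c j @ Z)"
      by (simp add: y_eq)
    have "p = [] \<Longrightarrow> j \<noteq> a" using hd y_eq ab by (auto simp: run_Cons)
    from run_div[OF g p(1) ab this p(2) x(1) _ _ eq2] j len y_eq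
    obtain x Z where x: "x \<in> DL" and Z: "S # P0 \<approx> x @ Dl c k a b @ Z" by auto
    have lenS: "length (S # P0) < N" using y' .
    have lenxZ: "length (x @ Dl c k a b @ Z) = length (S # P0)" using eq_length[OF Z] by simp
    show ?thesis
    proof (cases "b = k")
      case False
      have "S # P0 \<approx> c (Suc b) # x @ run c (Suc (Suc b)) k @ S # lo c a @ Z"
        by (rule eqI) (use False ab x in \<open>simp add: eqD[OF Z, simplified] run_Cons[of "Suc b"] act_comm1[symmetric]\<close>)
      from head_Sc_D[OF head_relI[OF g this]] lenS show ?thesis
        unfolding ends_def by (force intro!: exI[of _ "Suc k"])
    next
      case True
      then have Z': "S # P0 \<approx> x @ S # lo c a @ Z" using Z by simp
      have "\<exists>W. P0 \<approx> lo c a @ W"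
      proof (cases x)
        case Nil
        then have "S # P0 \<approx> S # lo c a @ Z" using Z' by simp
        from head_same_D[OF head_relI[OF g this]] lenS show ?thesis by auto
      next
        case (Cons v x1)
        then obtain q where q: "v = d q" "q \<in> {1..l}" using x by auto
        have "head_rel (S # P0) (d q # x1 @ S # lo c a @ Z)"
          using head_relI[OF g Z'] lenS Cons q by simp
        \<comment> \<open>Being divisible by \<open>d q\<close>, the word \<open>S # P0\<close> is
          divisible by every letter of that family; an index \<open>e \<noteq> q\<close> excludes
          the first alternative of \<open>IH\<close>.\<close>
        from flip.head_Sc_D[unfolded head_flip, OF this] obtain P2 where P2: "P0 \<approx> lo d (Suc l) @ P2"
          by auto
        obtain e where e: "e \<in> {1..l}" "e \<noteq> q" using flip.other_index by blast
        have "x @ S # lo c a @ Z \<approx> d e # Dl d l e e @ P2"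
          using eq_trans[OF eq_sym[OF Z'] eq_trans[OF eq_Cons[OF P2] flip.full_div'[OF e(1)]]] .
        from IH[OF x e(1) this] lenxZ \<open>y \<noteq> []\<close> Cons q e True
        have "flip.ends x (lo c a @ Z)" by auto
        from flip.ends_cancel[unfolded head_rel_upto_flip, OF g lo_in_lists this] lenxZ ab lenS
        have "flip.ends x Z" by auto
        from flip.endsE[OF this x] obtain i x0 Z4 where i: "1 \<le> i" "i \<le> Suc l" "x = x0 @ run d i l"
          "Z \<approx> lo d i @ Z4" "x0 \<in> DL" .
        \<comment> \<open>The end of \<open>x\<close>, \<open>S\<close> and the start of
          \<open>Z\<close> form a full block of the other family, which commutes with
          \<open>x0\<close>. Moving its \<open>S\<close> to the front makes \<open>S\<close>
          cancel.\<close>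
        have "S # P0 \<approx> S # lo c a @ lo d (Suc l) @ x0 @ Z4"
        proof (rule eqI)
          fix A
          have la: "lo c a \<in> CL" using ab by (intro lo_in_lists) auto
          have "act (S # P0) A = act x0 (act (run d i l) (lett S (act (lo c a) (act (lo d i) (act Z4 A)))))"
            by (simp add: eqD[OF Z', simplified] eqD[OF i(4)] i(3))
          also have "\<dots> = act x0 (act (lo d (Suc l)) (lett S (act (lo c a) (act Z4 A))))"
            using i by (simp add: act_comm[OF la lo_in_lists] flip.act_rotate)
          also have "\<dots> = act (lo d (Suc l)) (lett S (act x0 (act (lo c a) (act Z4 A))))"
            using i by (simp add: flip.full_central)
          also have "\<dots> = act (S # lo c a @ lo d (Suc l) @ x0 @ Z4) A"
            using i by (simp add: flip.S_comm_lo act_comm[OF la] flip.full_lo_in_lists)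
          finally show "act (S # P0) A = act (S # lo c a @ lo d (Suc l) @ x0 @ Z4) A" .
        qed
        from head_same_D[OF head_relI[OF g this]] lenS show ?thesis by auto
      qed
      then show ?thesis using y_eq True ab unfolding ends_def
        by (force intro!: exI[of _ a])
    qed
  qed
qed

end

context fan
begin

text \<open>Each family calls the other on shorter words through \<open>IH\<close> of
  \<open>div_step\<close>, so both statements share one induction on the length \<open>n\<close>,
  with the bound \<open>N\<close> fixed.\<close>

lemma div_both:
  assumes g: "head_rel_upto N"
  shows "(\<forall>y P j V. y \<in> CL \<longrightarrow> j \<in> {1..k} \<longrightarrow> y @ S # P \<approx> c j # V \<longrightarrow> length (y @ S # P) = n \<longrightarrow> n \<le> N
           \<longrightarrow> (\<exists>y1. y = c j # y1) \<or> ends y P)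
       \<and> (\<forall>y P j V. y \<in> DL \<longrightarrow> j \<in> {1..l} \<longrightarrow> y @ S # P \<approx> d j # V \<longrightarrow> length (y @ S # P) = n \<longrightarrow> n \<le> N
           \<longrightarrow> (\<exists>y1. y = d j # y1) \<or> flip.ends y P)"
proof (induction n rule: less_induct)
  case (less n)
  show ?case
  proof (intro conjI allI impI)
    fix y P j V
    assume A: "y \<in> CL" "j \<in> {1..k}" "y @ S # P \<approx> c j # V" "length (y @ S # P) = n" "n \<le> N"
    show "(\<exists>y1. y = c j # y1) \<or> ends y P"
    proof (rule div_step[OF g _ A(1-3)])
      fix x P' i W
      assume B: "x \<in> DL" "i \<in> {1..l}" "x @ S # P' \<approx> d i # W" "length (x @ S # P') < length (y @ S # P)"
      then have "length (x @ S # P') < n" using A(4) by simp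
      from less.IH[OF this, THEN conjunct2, rule_format, OF B(1-3) HOL.refl] this A(5)
      show "(\<exists>x1. x = d i # x1) \<or> flip.ends x P'" by simp
    qed (use A in simp)
  next
    fix y P j V
    assume A: "y \<in> DL" "j \<in> {1..l}" "y @ S # P \<approx> d j # V" "length (y @ S # P) = n" "n \<le> N"
    show "(\<exists>y1. y = d j # y1) \<or> flip.ends y P"
    proof (rule flip.div_step[unfolded head_rel_upto_flip, OF g _ A(1-3)])
      fix x P' i W
      assume B: "x \<in> CL" "i \<in> {1..k}" "x @ S # P' \<approx> c i # W" "length (x @ S # P') < length (y @ S # P)"
      then have "length (x @ S # P') < n" using A(4) by simp
      from less.IH[OF this, THEN conjunct1, rule_format, OF B(1-3) HOL.refl] this A(5)
      show "(\<exists>x1. x = c i # x1) \<or> ends x P'" by simp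
    qed (use A in simp)
  qed
qed

lemma letter_div:
  assumes "head_rel_upto N" "y \<in> CL" "j \<in> {1..k}" "y @ S # P \<approx> c j # V" "length (y @ S # P) \<le> N"
  shows "(\<exists>y1. y = c j # y1) \<or> ends y P"
  using div_both[OF assms(1), of "length (y @ S # P)"] assms by blast

text \<open>Common first letters are cancelled. At the first difference the first letter of one word
  divides the other side, where \<open>letter_div\<close> gives \<open>ends\<close>; then every
  letter of the family divides, and a second index gives \<open>ends\<close> for the first word
  too.\<close>

lemma S_prefix_compare:
  assumes g: "head_rel_upto N" and "x \<in> CL" "x' \<in> CL" "x @ S # P \<approx> x' @ S # P'" "length (x @ S # P) \<le> N"
  shows "x = x' \<or> ends x P \<and> ends x' P'"
  using assms(2-)
proof (induction x arbitrary: x' rule: list.induct)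
  case Nil
  show ?case
  proof (cases x')
    case (Cons v x1)
    then obtain q where q: "v = c q" "q \<in> {1..k}" using Nil by auto
    have *: "ends [] P"
      using letter_div[OF g Nil(1) q(2), of P] Nil Cons q by auto
    obtain e where e: "e \<in> {1..k}" "e \<noteq> q" using other_index by blast
    from ends_div[OF * Nil(1) e(1)] obtain V where "x' @ S # P' \<approx> c e # V"
      using eq_trans[OF eq_sym[OF Nil(3)]] by blast
    from letter_div[OF g Nil(2) e(1) this] Nil Cons q e have "ends x' P'"
      using eq_length[OF Nil(3)] by auto
    with * show ?thesis by simp
  qed simp
next
  case (Cons v x1)
  then obtain q where q: "v = c q" "q \<in> {1..k}" by auto
  have len': "length (x' @ S # P') \<le> N" using eq_length[OF Cons.prems(3)] Cons.prems(4) by simp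
  show ?case
  proof (cases "x' \<noteq> [] \<and> hd x' = v")
    case True
    then obtain x1' where x': "x' = v # x1'" by (cases x') auto
    have "x1 @ S # P \<approx> x1' @ S # P'"
      using head_same_D[OF head_relI[OF g]] Cons.prems x' by auto
    from Cons.IH[OF _ _ this] Cons.prems x' have "x1 = x1' \<or> ends x1 P \<and> ends x1' P'" by auto
    then show ?thesis using x' unfolding ends_def by (metis append_Cons)
  next
    case False
    have e': "ends x' P'"
      using letter_div[OF g Cons.prems(2) q(2) _ len', of "x1 @ S # P"] eq_sym[OF Cons.prems(3)] q False by auto
    obtain e where e: "e \<in> {1..k}" "e \<noteq> q" using other_index by blast
    from ends_div[OF e' Cons.prems(2) e(1)] obtain V where "(v # x1) @ S # P \<approx> c e # V"
      using eq_trans[OF Cons.prems(3)] by blast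
    from letter_div[OF g Cons.prems(1) e(1) this Cons.prems(4)] q e e' show ?thesis by auto
  qed
qed

text \<open>The end of \<open>x\<close> closes with \<open>S\<close> and the start of
  \<open>Z\<close> to a full block of the other family, with which the rest of \<open>x\<close>
  commutes. The witness \<open>Z2\<close> is independent of \<open>a\<close> and \<open>b\<close>,
  so that one block may be exchanged for another.\<close>

lemma ends_normal:
  assumes "x \<in> DL" "flip.ends x Z"
  shows "\<exists>Z2. \<forall>a b. 1 \<le> a \<longrightarrow> a \<le> Suc k \<longrightarrow> x @ Dl c k a b @ Z \<approx> Dl c k a b @ lo d (Suc l) @ Z2"
proof -
  from flip.endsE[OF assms(2,1)] obtain e x0 Z1 where e: "1 \<le> e" "e \<le> Suc l" "x = x0 @ run d e l"
    "Z \<approx> lo d e @ Z1" "x0 \<in> DL" .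
  have "x @ Dl c k a b @ Z \<approx> Dl c k a b @ lo d (Suc l) @ x0 @ Z1" if "1 \<le> a" "a \<le> Suc k" for a b
  proof (rule eqI)
    fix A
    have la: "lo c a \<in> CL" using that by (intro lo_in_lists) auto
    have rb: "run c (Suc b) k \<in> CL" by (rule run_in_lists) auto
    have "act (x @ Dl c k a b @ Z) A
      = act (run c (Suc b) k) (act x0 (act (run d e l) (lett S (act (lo c a) (act (lo d e) (act Z1 A))))))"
      using e by (simp add: eqD[OF e(4)] act_comm[OF rb] run_in_lists)
    also have "\<dots> = act (run c (Suc b) k) (act x0 (act (lo d (Suc l)) (lett S (act (lo c a) (act Z1 A)))))"
      using e by (simp add: act_comm[OF la lo_in_lists] flip.act_rotate)
    also have "\<dots> = act (run c (Suc b) k) (act (lo d (Suc l)) (lett S (act x0 (act (lo c a) (act Z1 A)))))"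
      using e by (simp add: flip.full_central)
    also have "\<dots> = act (Dl c k a b @ lo d (Suc l) @ x0 @ Z1) A"
      using e by (simp add: flip.S_comm_lo[symmetric] act_comm[OF la] flip.full_lo_in_lists)
    finally show "act (x @ Dl c k a b @ Z) A = act (Dl c k a b @ lo d (Suc l) @ x0 @ Z1) A" .
  qed
  then show ?thesis by blast
qed

end

context fan
begin

text \<open>After the letters following \<open>c i\<close> are cancelled,
  \<open>S_prefix_compare\<close> leaves two cases: equal factors, or factors that
  \<open>ends_normal\<close> moves to the right of every block at once, with
  \<open>x'' = []\<close>. The clause on \<open>x''\<close> forces \<open>x'' = []\<close> when one
  factor is empty, as \<open>head_trans_Scc\<close> requires.\<close>

lemma common_form:
  assumes g: "head_rel_upto N" and x: "x \<in> DL" "x' \<in> DL" and i: "i \<in> {1..k}"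
    and eq: "x @ Dl c k i i @ Z \<approx> x' @ Dl c k i i @ Z'"
    and len: "length (x @ Dl c k i i @ Z) \<le> N"
  shows "\<exists>x''\<in>DL. \<exists>Z''. (x'' = [] \<or> x'' = x \<and> x'' = x') \<and>
    (\<forall>j\<in>{1..k}. x @ Dl c k j j @ Z \<approx> x'' @ Dl c k j j @ Z'' \<and>
                x' @ Dl c k j j @ Z' \<approx> x'' @ Dl c k j j @ Z'')"
proof -
  have r: "run c (Suc i) k \<in> CL" by (rule run_in_lists) auto
  have li: "lo c i \<in> CL" using i by (intro lo_in_lists) auto
  have "run c (Suc i) k @ x @ S # lo c i @ Z \<approx> run c (Suc i) k @ x' @ S # lo c i @ Z'"
    by (rule eqI) (use eqD[OF eq] in \<open>simp add: act_comm[OF r] x\<close>)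
  from cancel_left[OF g this] len have eq': "x @ S # lo c i @ Z \<approx> x' @ S # lo c i @ Z'" by simp
  have len': "length (x @ S # lo c i @ Z) \<le> N" "length (x' @ S # lo c i @ Z') \<le> N"
    using len eq_length[OF eq'] by auto
  from flip.S_prefix_compare[unfolded head_rel_upto_flip, OF g x eq' len'(1)] show ?thesis
  proof
    assume xx: "x = x'"
    then have "Z \<approx> Z'" using cancel_left[OF g, of "x @ S # lo c i"] eq' len' by simp
    then have "x @ Dl c k j j @ Z \<approx> x @ Dl c k j j @ Z'" for j
      by (intro eqI) (simp add: eqD)
    with xx x show ?thesis by blast
  next
    assume "flip.ends x (lo c i @ Z) \<and> flip.ends x' (lo c i @ Z')"
    then have e: "flip.ends x Z" "flip.ends x' Z'"
      using flip.ends_cancel[unfolded head_rel_upto_flip, OF g li] len' by auto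
    from ends_normal[OF x(1) e(1)] obtain Z2 where
      Z2: "\<And>a. 1 \<le> a \<Longrightarrow> a \<le> Suc k \<Longrightarrow> x @ Dl c k a a @ Z \<approx> Dl c k a a @ lo d (Suc l) @ Z2" by blast
    from ends_normal[OF x(2) e(2)] obtain Z2' where
      Z2': "\<And>a. 1 \<le> a \<Longrightarrow> a \<le> Suc k \<Longrightarrow> x' @ Dl c k a a @ Z' \<approx> Dl c k a a @ lo d (Suc l) @ Z2'" by blast
    have i': "1 \<le> i" "i \<le> Suc k" using i by auto
    have "Dl c k i i @ lo d (Suc l) @ Z2 \<approx> Dl c k i i @ lo d (Suc l) @ Z2'"
      using eq_trans[OF eq_sym[OF Z2[OF i']] eq_trans[OF eq Z2'[OF i']]] .
    with cancel_left[OF g, of "Dl c k i i @ lo d (Suc l)" Z2 Z2'] eq_length[OF Z2[OF i']] len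
    have Z: "Z2 \<approx> Z2'" by simp
    have "x @ Dl c k j j @ Z \<approx> [] @ Dl c k j j @ lo d (Suc l) @ Z2'" if "1 \<le> j" "j \<le> Suc k" for j
      by (rule eqI) (use eqD[OF Z2[OF that]] in \<open>simp add: eqD[OF Z]\<close>)
    moreover have "x' @ Dl c k j j @ Z' \<approx> [] @ Dl c k j j @ lo d (Suc l) @ Z2'" if "1 \<le> j" "j \<le> Suc k" for j
      using Z2'[OF that] by simp
    ultimately show ?thesis by (intro bexI[of _ "[]"] exI[of _ "lo d (Suc l) @ Z2'"]) auto
  qed
qed

section \<open>Transitivity\<close>

text \<open>
  In \<open>head_trans_pqr\<close> the letters \<open>p\<close>, \<open>q\<close>, \<open>r\<close> are the kinds of the first letters of three equal words.
\<close>

lemma Dl_lo: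
  assumes "i \<in> {1..k}" "j \<in> {1..l}"
  shows "Dl c k i i @ lo d (Suc l) @ Z \<approx> d j # run c (Suc i) k @ Dl d l j j @ lo c i @ Z"
proof (rule eqI)
  fix A
  have li: "lo c i \<in> CL" using assms by (intro lo_in_lists) auto
  have ri: "run c (Suc i) k \<in> CL" by (rule run_in_lists) auto
  show "act (Dl c k i i @ lo d (Suc l) @ Z) A = act (d j # run c (Suc i) k @ Dl d l j j @ lo c i @ Z) A"
    using assms flip.letter_Dl[OF assms(2), of "act (lo c i) (act Z A)"]
    by (simp add: act_comm[OF li flip.full_lo_in_lists] flip.S_comm_lo flip.act_comm1[OF assms(2) ri])
qed

text \<open>The right side does not mention \<open>i\<close>; \<open>head_trans_ccd\<close> uses
  this to replace one letter \<open>c i\<close> by another.\<close>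

lemma c_Dl:
  assumes "i \<in> {1..k}" "j \<in> {1..l}"
  shows "c i # run c (Suc i) k @ Dl d l j j @ lo c i @ Z \<approx> lo c (Suc k) @ Dl d l j j @ Z"
proof (rule eqI)
  fix A
  have li: "lo c i \<in> CL" using assms by (intro lo_in_lists) auto
  have lj: "lo d j \<in> DL" using assms by (intro lo_in_lists) auto
  have ri: "run c (Suc i) k \<in> CL" by (rule run_in_lists) auto
  have rj: "run d (Suc j) l \<in> DL" by (rule run_in_lists) auto
  show "act (c i # run c (Suc i) k @ Dl d l j j @ lo c i @ Z) A = act (lo c (Suc k) @ Dl d l j j @ Z) A"
    using assms
    by (simp add: act_comm[OF li lj, symmetric] act_comm[OF ri rj] act_comm1[OF assms(1) rj] letter_Dl
        act_comm[OF full_lo_in_lists rj])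
qed

lemma lo_Dl:
  assumes "j \<in> {1..l}"
  shows "Dl d l j j @ lo c (Suc k) @ Z \<approx> lo c (Suc k) @ Dl d l j j @ Z"
proof (rule eqI)
  fix A
  have lj: "lo d j \<in> DL" using assms by (intro lo_in_lists) auto
  have rj: "run d (Suc j) l \<in> DL" by (rule run_in_lists) auto
  show "act (Dl d l j j @ lo c (Suc k) @ Z) A = act (lo c (Suc k) @ Dl d l j j @ Z) A"
    by (simp add: act_comm[OF full_lo_in_lists lj, symmetric] act_comm[OF full_lo_in_lists rj] S_comm_lo)
qed

lemma eq_append: "x \<approx> y \<Longrightarrow> p @ x \<approx> p @ y"
  using eq_cong[of x y p "[]"] by simp

lemma head_trans_Scd:
  assumes g: "head_rel_upto N" and ij: "i \<in> {1..k}" "j \<in> {1..l}" and len: "length Y \<le> N"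
    and X: "X \<approx> lo c (Suc k) @ Z" and Y: "Y \<approx> Dl c k i i @ Z" "Y \<approx> d j # V" and W: "W \<approx> c i # V"
  shows "head_rel (S # X) (d j # W)"
proof -
  have li: "lo c i \<in> CL" using ij by (intro lo_in_lists) auto
  have ri: "run c (Suc i) k \<in> CL" by (rule run_in_lists) auto
  \<comment> \<open>The letter \<open>d j\<close> is pushed through the block: past
    \<open>run c (Suc i) k\<close>, through \<open>S\<close>, where it grows to a full run, and past
    \<open>lo c i\<close>.\<close>
  have "run c (Suc i) k @ S # lo c i @ Z \<approx> d j # V"
    using eq_trans[OF eq_sym[OF Y(1)] Y(2)] by simp
  from comm_div1[OF g ri ij(2) this] eq_length[OF Y(1)] len obtain V1 where
    V1: "S # lo c i @ Z \<approx> d j # V1" "V \<approx> run c (Suc i) k @ V1" by auto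
  from flip.head_Sc_D[unfolded head_flip, OF head_relI[OF g V1(1)]] eq_length[OF Y(1)] len obtain V2 where
    V2: "lo c i @ Z \<approx> lo d (Suc l) @ V2" "V1 \<approx> Dl d l j j @ V2" by auto
  from comm_div[OF g li flip.full_lo_in_lists V2(1)] eq_length[OF Y(1)] len obtain V3 where
    V3: "Z \<approx> lo d (Suc l) @ V3" "V2 \<approx> lo c i @ V3" by auto
  have "X \<approx> lo d (Suc l) @ lo c (Suc k) @ V3"
    by (rule eqI) (simp add: eqD[OF X] eqD[OF V3(1)] act_comm[OF full_lo_in_lists flip.full_lo_in_lists])
  moreover have "W \<approx> Dl d l j j @ lo c (Suc k) @ V3"
  proof -
    have "W \<approx> c i # run c (Suc i) k @ Dl d l j j @ lo c i @ V3"
      by (rule eqI) (simp add: eqD[OF W] eqD[OF V1(2)] eqD[OF V2(2)] eqD[OF V3(2)])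
    from eq_trans[OF this eq_trans[OF c_Dl[OF ij] eq_sym[OF lo_Dl[OF ij(2)]]]] show ?thesis .
  qed
  ultimately show ?thesis by (rule head_Sd[OF ij(2)])
qed

text \<open>Either \<open>x\<close> starts with \<open>d j\<close>, which then cancels, or
  \<open>ends_normal\<close> moves \<open>x\<close> to the right of the block, and
  \<open>Dl_lo\<close> brings \<open>d j\<close> to the front for every index.\<close>

lemma head_trans_ccd:
  assumes g: "head_rel_upto N" and ij: "i \<in> {1..k}" "h \<in> {1..k}" "j \<in> {1..l}" and len: "length Y \<le> N"
    and x: "x \<in> DL" and X: "X \<approx> x @ Dl c k h h @ Z" and Y: "Y \<approx> x @ Dl c k i i @ Z" "Y \<approx> d j # V"
    and W: "W \<approx> c i # V"
  shows "head_rel (c h # X) (d j # W)"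
proof -
  have li: "lo c i \<in> CL" using ij by (intro lo_in_lists) auto
  have ri: "run c (Suc i) k \<in> CL" by (rule run_in_lists) auto
  have eq0: "x @ Dl c k i i @ Z \<approx> d j # V" using eq_trans[OF eq_sym[OF Y(1)] Y(2)] .
  have eq1: "run c (Suc i) k @ x @ S # lo c i @ Z \<approx> d j # V"
    by (rule eqI) (use eqD[OF eq0] in \<open>simp add: act_comm[OF ri x]\<close>)
  from comm_div1[OF g ri ij(3) eq1] eq_length[OF Y(1)] len obtain V1 where
    V1: "x @ S # lo c i @ Z \<approx> d j # V1" by auto
  have lenx: "length (x @ S # lo c i @ Z) \<le> N" using eq_length[OF Y(1)] len by simp
  from flip.letter_div[unfolded head_rel_upto_flip, OF g x ij(3) V1 lenx] show ?thesis
  proof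
    assume "\<exists>x1. x = d j # x1"
    then obtain x1 where "x = d j # x1" by blast
    with x have x1: "x = d j # x1" "x1 \<in> DL" by simp_all
    have "V \<approx> x1 @ Dl c k i i @ Z"
      using head_same_D[OF head_relI[OF g]] eq_sym[OF eq0] x1 len eq_length[OF Y(2)] by auto
    then have "W \<approx> c h # x1 @ Dl c k h h @ Z"
      by (intro eqI) (simp add: eqD[OF W] eqD act_comm1[OF _ x1(2)] letter_Dl ij del: atLeastAtMost_iff)
    moreover have "X \<approx> d j # x1 @ Dl c k h h @ Z" using X x1 by simp
    ultimately show ?thesis using head_cd ij by blast
  next
    assume "flip.ends x (lo c i @ Z)"
    from flip.ends_cancel[unfolded head_rel_upto_flip, OF g li this] lenx have "flip.ends x Z" by simp
    from ends_normal[OF x this] obtain Z2 where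
      Z2: "\<And>a. a \<in> {1..k} \<Longrightarrow> x @ Dl c k a a @ Z \<approx> Dl c k a a @ lo d (Suc l) @ Z2" by force
    have *: "x @ Dl c k a a @ Z \<approx> d j # run c (Suc a) k @ Dl d l j j @ lo c a @ Z2"
      if "a \<in> {1..k}" for a
      using eq_trans[OF Z2[OF that] Dl_lo[OF that ij(3)]] .
    have V: "V \<approx> run c (Suc i) k @ Dl d l j j @ lo c i @ Z2"
      using head_same_D[OF head_relI[OF g eq_trans[OF eq_sym[OF Y(2)] eq_trans[OF Y(1) *[OF ij(1)]]]]]
        len eq_length[OF Y(2)] by simp
    have "W \<approx> c h # run c (Suc h) k @ Dl d l j j @ lo c h @ Z2"
      using eq_trans[OF W eq_trans[OF eq_Cons[OF V] eq_trans[OF c_Dl[OF ij(1,3)] eq_sym[OF c_Dl[OF ij(2,3)]]]]] .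
    with eq_trans[OF X *[OF ij(2)]] show ?thesis using head_cd ij by blast
  qed
qed

lemma head_trans_dcd:
  assumes g: "head_rel_upto N" and ij: "h \<in> {1..k}" "i \<in> {1..l}" "j \<in> {1..l}" and len: "length Y \<le> N"
    and X: "X \<approx> c h # Z" and Y: "Y \<approx> d i # Z" "Y \<approx> d j # V" and W: "W \<approx> c h # V"
  shows "head_rel (d i # X) (d j # W)"
proof -
  have h: "head_rel (d i # Z) (d j # V)"
    using head_relI[OF g eq_trans[OF eq_sym[OF Y(1)] Y(2)]] eq_length[OF Y(1)] len by simp
  show ?thesis
  proof (cases "i = j")
    case True
    with h have "Z \<approx> V" using head_same_D by blast
    from eq_trans[OF X eq_trans[OF eq_Cons[OF this] eq_sym[OF W]]] True show ?thesis
      by (simp add: head_same)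
  next
    case False
    from flip.head_cc_D[unfolded head_flip, OF h this] obtain x Z2 where x: "x \<in> CL"
      "Z \<approx> x @ Dl d l i i @ Z2" "V \<approx> x @ Dl d l j j @ Z2" by blast
    \<comment> \<open>The shared letter \<open>c h\<close> becomes part of the factor in
      \<open>head_dd\<close>.\<close>
    have "X \<approx> (c h # x) @ Dl d l i i @ Z2" "W \<approx> (c h # x) @ Dl d l j j @ Z2"
      using eq_trans[OF X eq_Cons[OF x(2)]] eq_trans[OF W eq_Cons[OF x(3)]] by simp_all
    with head_dd[OF ij(2,3) False, of "c h # x"] x(1) ij(1) show ?thesis by auto
  qed
qed

lemma head_trans_ccc:
  assumes g: "head_rel_upto N" and ij: "h \<in> {1..k}" "i \<in> {1..k}" "j \<in> {1..k}" and len: "length Y \<le> N"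
    and x: "x \<in> DL" "x' \<in> DL" and X: "X \<approx> x @ Dl c k i i @ Z" and Y: "Y \<approx> x @ Dl c k h h @ Z"
    "Y \<approx> x' @ Dl c k h h @ Z'" and W: "W \<approx> x' @ Dl c k j j @ Z'"
  shows "head_rel (c i # X) (c j # W)"
proof -
  from common_form[OF g x ij(1) eq_trans[OF eq_sym[OF Y(1)] Y(2)]] eq_length[OF Y(1)] len
  obtain x'' Z'' where x'': "x'' \<in> DL" "\<And>j. j\<in>{1..k} \<Longrightarrow> x @ Dl c k j j @ Z \<approx> x'' @ Dl c k j j @ Z''"
    "\<And>j. j\<in>{1..k} \<Longrightarrow> x' @ Dl c k j j @ Z' \<approx> x'' @ Dl c k j j @ Z''"
    by (metis (no_types, lifting))
  have XW: "X \<approx> x'' @ Dl c k i i @ Z''" "W \<approx> x'' @ Dl c k j j @ Z''"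
    using eq_trans[OF X x''(2)[OF ij(2)]] eq_trans[OF W x''(3)[OF ij(3)]] by simp_all
  show ?thesis
  proof (cases "i = j")
    case True
    with eq_trans[OF XW(1) eq_sym] XW(2) show ?thesis by (auto intro: head_same)
  next
    case False
    then show ?thesis using head_cc[OF ij(2,3) _ x''(1) XW] by simp
  qed
qed

lemma head_trans_Scc:
  assumes g: "head_rel_upto N" and ij: "i \<in> {1..k}" "j \<in> {1..k}" and len: "length Y \<le> N"
    and x: "x \<in> DL" and X: "X \<approx> lo c (Suc k) @ Z" and Y: "Y \<approx> Dl c k i i @ Z"
    "Y \<approx> x @ Dl c k i i @ Z'" and W: "W \<approx> x @ Dl c k j j @ Z'"
  shows "head_rel (S # X) (c j # W)"
proof -
  have Y1: "Y \<approx> [] @ Dl c k i i @ Z" using Y(1) by simp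
  from common_form[OF g lists.Nil x ij(1) eq_trans[OF eq_sym[OF Y1] Y(2)]] eq_length[OF Y(1)] len
  obtain x'' Z'' where *: "x'' = [] \<or> x'' = [] \<and> x'' = x"
    "\<forall>j\<in>{1..k}. [] @ Dl c k j j @ Z \<approx> x'' @ Dl c k j j @ Z'' \<and>
       x @ Dl c k j j @ Z' \<approx> x'' @ Dl c k j j @ Z''"
    by fastforce
  then have x'': "\<And>j. j\<in>{1..k} \<Longrightarrow> Dl c k j j @ Z \<approx> Dl c k j j @ Z''"
    "\<And>j. j\<in>{1..k} \<Longrightarrow> x @ Dl c k j j @ Z' \<approx> Dl c k j j @ Z''"
    by auto
  have "Z \<approx> Z''" using cancel_left[OF g, of "Dl c k i i"] x''(1)[OF ij(1)] eq_length[OF Y(1)] len by simp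
  from head_Sc[OF ij(2) eq_trans[OF X eq_append[OF this]] eq_trans[OF W x''(2)[OF ij(2)]]]
  show ?thesis .
qed

lemma head_trans_ScS:
  assumes g: "head_rel_upto N" and len: "length Y \<le> N"
    and X: "X \<approx> lo c (Suc k) @ Z" and Y: "Y \<approx> Dl c k i i @ Z" "Y \<approx> Dl c k i i @ Z'"
    and W: "W \<approx> lo c (Suc k) @ Z'"
  shows "head_rel (S # X) (S # W)"
proof -
  have "Z \<approx> Z'"
    using cancel_left[OF g, of "Dl c k i i"] eq_trans[OF eq_sym[OF Y(1)] Y(2)] eq_length[OF Y(1)] len by simp
  from eq_trans[OF X eq_trans[OF eq_append[OF this] eq_sym[OF W]]] show ?thesis by (rule head_same)
qed

lemma head_trans_cSc:
  assumes g: "head_rel_upto N" and ij: "i \<in> {1..k}" "j \<in> {1..k}" and len: "length Y \<le> N"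
    and Y: "Y \<approx> lo c (Suc k) @ Z" "Y \<approx> lo c (Suc k) @ Z'"
    and X: "X \<approx> Dl c k i i @ Z" and W: "W \<approx> Dl c k j j @ Z'"
  shows "head_rel (c i # X) (c j # W)"
proof -
  have "Z \<approx> Z'"
    using cancel_left[OF g] eq_trans[OF eq_sym[OF Y(1)] Y(2)] eq_length[OF Y(1)] len by simp
  from eq_trans[OF X eq_append[OF this, of "Dl c k i i"]]
  have X': "X \<approx> [] @ Dl c k i i @ Z'" by simp
  show ?thesis
  proof (cases "i = j")
    case True
    with eq_trans[OF X' eq_sym] W show ?thesis by (auto intro: head_same)
  next
    case False
    then show ?thesis using head_cc[OF ij _ _ X'] W by simp
  qed
qed

lemma head_trans_cSd:
  assumes g: "head_rel_upto N" and ij: "i \<in> {1..k}" "j \<in> {1..l}" and len: "length Y \<le> N"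
    and Y: "Y \<approx> lo c (Suc k) @ Z" "Y \<approx> lo d (Suc l) @ Z'"
    and X: "X \<approx> Dl c k i i @ Z" and W: "W \<approx> Dl d l j j @ Z'"
  shows "head_rel (c i # X) (d j # W)"
proof -
  \<comment> \<open>Both full runs divide \<open>Y\<close>, hence so does their product.\<close>
  from comm_div[OF g full_lo_in_lists flip.full_lo_in_lists eq_trans[OF eq_sym[OF Y(1)] Y(2)]] eq_length[OF Y(1)] len
  obtain Z2 where Z2: "Z \<approx> lo d (Suc l) @ Z2" "Z' \<approx> lo c (Suc k) @ Z2" by auto
  have "X \<approx> Dl c k i i @ lo d (Suc l) @ Z2"
    using eq_trans[OF X eq_append[OF Z2(1), of "Dl c k i i"]] by simp
  from eq_trans[OF this Dl_lo[OF ij]]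
  have X': "X \<approx> d j # run c (Suc i) k @ Dl d l j j @ lo c i @ Z2" .
  have "W \<approx> Dl d l j j @ lo c (Suc k) @ Z2"
    using eq_trans[OF W eq_append[OF Z2(2), of "Dl d l j j"]] by simp
  from eq_trans[OF this eq_trans[OF lo_Dl[OF ij(2)] eq_sym[OF c_Dl[OF ij]]]]
  show ?thesis by (rule head_cd[OF ij X'])
qed

lemma head_trans_c:
  assumes g: "head_rel_upto N" and len: "length Y \<le> N" and "head_rel (c i # Y) a" "head_rel (c i # Y) e"
  shows "head_rel a e"
  using assms(3)
proof (cases rule: head_c_cases)
  case 1
  then show ?thesis using head_tail assms(4) by blast
next
  case a: 2
  from assms(4) show ?thesis
  proof (cases rule: head_c_cases)
    case 1
    then show ?thesis using head_tail assms(3) head_sym by blast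
  qed (use a in \<open>blast intro: head_trans_ScS[OF g len] head_trans_Scc[OF g _ _ len] head_trans_Scd[OF g _ _ len]\<close>)+
next
  case a: 3
  from assms(4) show ?thesis
  proof (cases rule: head_c_cases)
    case 1
    then show ?thesis using head_tail assms(3) head_sym by blast
  qed (use a in \<open>blast intro: head_trans_ccc[OF g _ _ _ len] head_sym[OF head_trans_Scc[OF g _ _ len]] head_trans_ccd[OF g _ _ _ len]\<close>)+
next
  case a: 4
  from assms(4) show ?thesis
  proof (cases rule: head_c_cases)
    case 1
    then show ?thesis using head_tail assms(3) head_sym by blast
  qed (use a in \<open>blast intro: head_trans_dcd[OF g _ _ _ len] head_sym[OF head_trans_Scd[OF g _ _ len]] head_sym[OF head_trans_ccd[OF g _ _ _ len]]\<close>)+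
qed

end

context fan
begin

lemma head_trans_S:
  assumes g: "head_rel_upto N" and len: "length Y \<le> N" and "head_rel (S # Y) a" "head_rel (S # Y) e"
  shows "head_rel a e"
  using assms(3)
proof (cases rule: head_S_cases)
  case 1
  then show ?thesis using head_tail assms(4) by blast
next
  case a: 2
  from assms(4) show ?thesis
  proof (cases rule: head_S_cases)
    case 1
    then show ?thesis using head_tail assms(3) head_sym by blast
  qed (use a in \<open>blast intro: head_trans_cSc[OF g _ _ len] head_trans_cSd[OF g _ _ len]\<close>)+
next
  case a: 3
  from assms(4) show ?thesis
  proof (cases rule: head_S_cases)
    case 1
    then show ?thesis using head_tail assms(3) head_sym by blast
  qed (use a in \<open>blast intro: flip.head_trans_cSc[unfolded head_rel_upto_flip head_flip, OF g _ _ len] head_sym[OF head_trans_cSd[OF g _ _ len]]\<close>)+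
qed

end

context fan
begin

lemma head_trans:
  assumes "head_rel_upto N" "length b \<le> Suc N" "head_rel a b" "head_rel b e"
  shows "head_rel a e"
proof -
  have ba: "head_rel b a" using assms(3) by (rule head_sym)
  show ?thesis
  proof (cases b)
    case Nil
    then show ?thesis using ba assms(4) by (auto elim: head_rel.cases)
  next
    case (Cons v Y)
    then have Y: "length Y \<le> N" using assms(2) by simp
    consider "v = S" | i where "v = c i" | j where "v = d j" | "v \<noteq> S" "v \<notin> range c" "v \<notin> range d"
      by blast
    then show ?thesis
    proof cases
      case 1
      then show ?thesis using head_trans_S[OF assms(1) Y] ba assms(4) Cons by blast
    next
      case 2
      then show ?thesis using head_trans_c[OF assms(1) Y] ba assms(4) Cons by blast
    next
      case 3
      then show ?thesis
        using flip.head_trans_c[unfolded head_rel_upto_flip head_flip, OF assms(1) Y] ba assms(4) Cons by blast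
    next
      \<comment> \<open>A letter outside both ranges and different from \<open>S\<close> occurs
        first only in \<open>head_same\<close>.\<close>
      case 4
      then obtain W where "a = v # W" "Y \<approx> W"
        using ba Cons by (auto elim: head_rel.cases)
      then show ?thesis using head_tail assms(4) Cons by blast
    qed
  qed
qed

section \<open>Division by longer words\<close>

text \<open>This makes the \<open>THE\<close> in \<open>Delta\<close> single-valued.\<close>

lemma run_eqD:
  assumes "run c a b = run c a' b'" "a \<le> b"
  shows "a = a' \<and> b = b'"
proof -
  have l: "Suc b - a = Suc b' - a'" using arg_cong[OF assms(1), of length] by simp
  then have "a' \<le> b'" using assms(2) by simp
  with assms have "a = a'" by (simp add: run_Cons)
  with l assms(2) \<open>a' \<le> b'\<close> show ?thesis by simp
qed

lemma Delta_S: "Delta c k [S] = lo c (Suc k)"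
  by (simp add: Delta_def lo_def)

lemma Delta_run:
  assumes "1 \<le> a" "a \<le> b" "b \<le> k"
  shows "Delta c k (run c a b) = Dl c k a b"
proof -
  have "run c a b \<noteq> [S]" using assms by (simp add: run_Cons)
  moreover have "(\<exists>a' b'. 1 \<le> a' \<and> a' \<le> b' \<and> b' \<le> k \<and> run c a b = run c a' b' \<and>
        e = run c (b' + 1) k @ [S] @ run c 1 (a' - 1)) \<longleftrightarrow> e = Dl c k a b" for e
  proof
    assume "e = Dl c k a b"
    then show "\<exists>a' b'. 1 \<le> a' \<and> a' \<le> b' \<and> b' \<le> k \<and> run c a b = run c a' b' \<and>
        e = run c (b' + 1) k @ [S] @ run c 1 (a' - 1)"
      using assms by (rule_tac exI[of _ a], rule_tac exI[of _ b]) (simp add: lo_def Suc_eq_plus1)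
  next
    assume "\<exists>a' b'. 1 \<le> a' \<and> a' \<le> b' \<and> b' \<le> k \<and> run c a b = run c a' b' \<and>
        e = run c (b' + 1) k @ [S] @ run c 1 (a' - 1)"
    then obtain a' b' where "run c a b = run c a' b'"
      and e: "e = run c (b' + 1) k @ [S] @ run c 1 (a' - 1)" by blast
    with run_eqD[of a b a' b'] assms show "e = Dl c k a b" by (simp add: lo_def Suc_eq_plus1)
  qed
  ultimately show ?thesis by (simp add: Delta_def)
qed

text \<open>A longer run that is a suffix of the word has \<open>run c a b\<close> as a proper
  suffix, so the letter before that is \<open>c (a - 1)\<close>; but this letter is the last one of
  \<open>p\<close>.\<close>

lemma CC_eq:
  assumes ab: "1 \<le> a" "a \<le> b" "b \<le> k" and p: "p \<noteq> [] \<longrightarrow> last p \<noteq> c (a - 1)"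
  shows "CC c k (p @ run c a b) = run c a b"
proof -
  let ?w = "p @ run c a b"
  let ?P = "\<lambda>v. suffix v ?w \<and> (\<exists>a b. 1 \<le> a \<and> a \<le> b \<and> b \<le> k \<and> v = run c a b)"
  have P: "?P (run c a b)" using ab by (auto simp: suffix_def)
  have max: "length v \<le> length (run c a b)" if v: "?P v" for v
  proof (rule ccontr)
    assume "\<not> ?thesis"
    then have len: "length (run c a b) < length v" by simp
    from v obtain a' b' where a': "v = run c a' b'" "1 \<le> a'" by blast
    have "suffix (run c a b) v"
      using suffix_length_suffix[of "run c a b" ?w v] P v len by simp
    then obtain v1 where v1: "v = v1 @ run c a b" unfolding suffix_def by blast
    then have "v1 \<noteq> []" using len by auto
    then obtain v2 e where v2: "v1 = v2 @ [e]" by (cases v1 rule: rev_cases) auto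
    have nth: "v ! i = c (a' + i)" if "i < length v" for i
      using that a' by (simp add: run_def del: upt_Suc)
    have "e = c (a' + length v2)" using nth[of "length v2"] v1 v2 by (simp add: nth_append)
    moreover have "c a = c (a' + length v1)"
      using nth[of "length v1"] v1 ab by (simp add: nth_append run_Cons)
    ultimately have "e = c (a - 1)" using v2 by simp
    moreover have "p \<noteq> []" "last p = e"
      using v v1 v2 by (auto simp: suffix_def)
    ultimately show False using p by simp
  qed
  \<comment> \<open>The rule \<open>arg_max_natI\<close> asks for a strict bound on the lengths,
    hence the \<open>Suc\<close>.\<close>
  have PC: "?P (CC c k ?w)"
    unfolding CC_def by (rule arg_max_natI[where P = ?P and b = "Suc (length ?w)"])
      (use P in \<open>blast, meson less_Suc_eq_le suffix_length_le\<close>)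
  have "length (CC c k ?w) = length (run c a b)"
    unfolding CC_def by (rule arg_max_equality[where P = ?P]) (use P max in auto)
  then show ?thesis
    using PC P by (metis suffix_length_suffix suffix_order.antisym order_refl)
qed

lemma RR_eq:
  assumes "1 \<le> a" "a \<le> b" "b \<le> k" "p \<noteq> [] \<longrightarrow> last p \<noteq> c (a - 1)"
  shows "RR c k (p @ run c a b) = p"
  by (simp add: RR_def CC_eq[OF assms])

text \<open>A full run of the other family at the end of \<open>x\<close> commutes with
  \<open>S\<close> and with the letters of the block, so it moves into \<open>Z\<close> and
  \<open>x\<close> gets shorter. This produces the condition in \<open>F1_rm\<close> and
  \<open>F2_rm\<close>.\<close>

lemma trim_full_suffix:
  assumes "x \<in> DL" "1 \<le> a" "a \<le> Suc k"
  shows "\<exists>x'\<in>DL. \<not> suffix (run d 1 l) x' \<and> (\<exists>Z'. x @ Dl c k a b @ Z \<approx> x' @ Dl c k a b @ Z')"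
  using assms(1)
proof (induction "length x" arbitrary: x Z rule: less_induct)
  case less
  show ?case
  proof (cases "suffix (run d 1 l) x")
    case True
    then obtain x1 where x1: "x = x1 @ lo d (Suc l)" by (auto simp: suffix_def lo_def)
    have la: "lo c a \<in> CL" using assms by (intro lo_in_lists) auto
    have rb: "run c (Suc b) k \<in> CL" by (rule run_in_lists) auto
    have *: "x @ Dl c k a b @ Z \<approx> x1 @ Dl c k a b @ lo d (Suc l) @ Z"
      by (rule eqI) (simp add: x1 act_comm[OF la flip.full_lo_in_lists] act_comm[OF rb flip.full_lo_in_lists, symmetric] flip.S_comm_lo)
    have "length x1 < length x" "x1 \<in> DL"
      using x1 l2 less(2) by (auto simp: lo_def run_def)
    from less(1)[OF this, of "lo d (Suc l) @ Z"] eq_trans[OF *] show ?thesis by blast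
  qed (use less in blast)
qed

text \<open>The run and its complement close up to the full block, past which \<open>p\<close>
  moves. This carries a description of \<open>Y\<close> back to one of \<open>X\<close>.\<close>

lemma run_Dl:
  assumes "p \<in> CL" "x \<in> DL" "1 \<le> a" "a \<le> b" "b \<le> k" "Y \<approx> x @ Dl c k a b @ Z"
  shows "(p @ run c a b) @ Y \<approx> x @ lo c (Suc k) @ S # p @ Z"
proof (rule eqI)
  fix A
  have r: "run c a b \<in> CL" using assms by (intro run_in_lists) auto
  have "act (run c a k) B = act (run c a b) (act (run c (Suc b) k) B)" for B
    using run_append[of a b k c] assms by (simp flip: act_append)
  then have "act (run c a b) (act (run c (Suc b) k) (lett S (act (lo c a) B))) = act (lo c (Suc k)) (lett S B)" for B
    using act_rotate[of a B] assms by simp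
  then show "act ((p @ run c a b) @ Y) A = act (x @ lo c (Suc k) @ S # p @ Z) A"
    by (simp add: eqD[OF assms(6)] act_comm[OF r assms(2)] act_comm[OF assms(1,2)] full_central[OF assms(1)])
qed

lemma word_div_S:
  assumes g: "\<And>N. head_rel_upto N" and w: "w \<in> CL" "w \<noteq> []" and eq: "S # X \<approx> w @ Y"
  shows "\<exists>Z. X \<approx> Delta c k [S] @ RR c k w @ Z \<and> Y \<approx> Delta c k (CC c k w) @ Z"
proof -
  from decompose[OF w] obtain p a b where w_eq: "w = p @ run c a b"
    and ab: "1 \<le> a" "a \<le> b" "b \<le> k" and p: "p \<in> CL" "p \<noteq> [] \<longrightarrow> last p \<noteq> c (a - 1)"
    by auto
  \<comment> \<open>The word \<open>S # X\<close> is read as the shape in \<open>run_div\<close>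
    with empty \<open>x\<close> and empty run, \<open>e = Suc k\<close>.\<close>
  have "(p @ run c a b) @ Y \<approx> [] @ run c (Suc k) k @ S # X"
    using eq_sym[OF eq] w_eq by simp
  from run_div[OF g p(1) ab _ p(2) _ _ _ this order_refl] ab obtain x Z where
    x: "x \<in> DL" and Z: "Y \<approx> x @ Dl c k a b @ Z" by auto
  have "\<exists>Z. Y \<approx> [] @ Dl c k a b @ Z"
  proof -
    \<comment> \<open>Comparing the factors \<open>[]\<close> and \<open>x\<close> before
      \<open>S\<close> shows that \<open>x\<close> is empty or can be moved to the right of the
      block.\<close>
    have "[] @ S # X \<approx> x @ S # (lo c (Suc k) @ p) @ Z"
    proof (rule eqI)
      fix A
      show "act ([] @ S # X) A = act (x @ S # (lo c (Suc k) @ p) @ Z) A"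
        using eqD[OF eq, of A] eqD[OF run_Dl[OF p(1) x ab Z], of A] w_eq by (simp add: S_comm_lo)
    qed
    from flip.S_prefix_compare[unfolded head_rel_upto_flip, OF g _ x this order_refl]
    have "x = [] \<or> flip.ends x ((lo c (Suc k) @ p) @ Z)" by auto
    then show ?thesis
    proof
      assume "flip.ends x ((lo c (Suc k) @ p) @ Z)"
      from flip.ends_cancel[unfolded head_rel_upto_flip, OF g _ this order_refl] full_lo_in_lists p(1)
      have "flip.ends x Z" by simp
      from ends_normal[OF x this] ab eq_trans[OF Z] show ?thesis by force
    qed (use Z in auto)
  qed
  then obtain Z where Z: "Y \<approx> [] @ Dl c k a b @ Z" by blast
  have "S # X \<approx> S # lo c (Suc k) @ p @ Z"
  proof (rule eqI)
    fix A
    show "act (S # X) A = act (S # lo c (Suc k) @ p @ Z) A"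
      using eqD[OF eq, of A] eqD[OF run_Dl[OF p(1) lists.Nil ab Z], of A] w_eq by (simp add: S_comm_lo)
  qed
  from head_same_D[OF head_relI[OF g this order_refl]] Z show ?thesis
    unfolding w_eq CC_eq[OF ab p(2)] RR_eq[OF ab p(2)] Delta_S Delta_run[OF ab] by auto
qed

lemma word_div_c:
  assumes g: "\<And>N. head_rel_upto N" and w: "w \<in> CL" "w \<noteq> []" and i: "i \<in> {1..k}"
    and hd: "\<not> prefix [c i] w" and eq: "c i # X \<approx> w @ Y"
  shows "\<exists>x\<in>DL. \<not> suffix (run d 1 l) x \<and> (\<exists>Z. X \<approx> x @ Delta c k [c i] @ RR c k w @ Z
            \<and> Y \<approx> x @ Delta c k (CC c k w) @ Z)"
proof -
  from decompose[OF w] obtain p a b where w_eq: "w = p @ run c a b"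
    and ab: "1 \<le> a" "a \<le> b" "b \<le> k" and p: "p \<in> CL" "p \<noteq> [] \<longrightarrow> last p \<noteq> c (a - 1)"
    by auto
  have hd': "hd w \<noteq> c i" using hd w(2) by (cases w) auto
  from c_div[OF g w hd' i eq_sym[OF eq] order_refl] obtain x Z where "x \<in> DL"
    "(p @ run c a b) @ Y \<approx> x @ run c i k @ S # lo c i @ Z" unfolding w_eq by blast
  moreover have "p = [] \<Longrightarrow> i \<noteq> a" using hd' w_eq ab by (auto simp: run_Cons)
  ultimately obtain x Z where "x \<in> DL" "Y \<approx> x @ Dl c k a b @ Z"
    using run_div[OF g p(1) ab _ p(2) _ _ _ _ order_refl] i by (metis atLeastAtMost_iff le_SucI)
  with trim_full_suffix[of x a b Z] ab obtain x Z where x: "x \<in> DL" "\<not> suffix (run d 1 l) x"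
    and Z: "Y \<approx> x @ Dl c k a b @ Z" by (meson eq_trans le_SucI order_trans)
  \<comment> \<open>Both sides equal \<open>x @ lo c (Suc k) @ S # p @ Z\<close>; cancelling
    \<open>c i\<close> then gives \<open>X\<close>.\<close>
  have "c i # X \<approx> c i # x @ Dl c k i i @ p @ Z"
  proof (rule eqI)
    fix A
    show "act (c i # X) A = act (c i # x @ Dl c k i i @ p @ Z) A"
      using eqD[OF eq, of A] eqD[OF run_Dl[OF p(1) x(1) ab Z], of A] w_eq
      by (simp add: act_comm1[OF i x(1)] letter_Dl[OF i])
  qed
  from head_same_D[OF head_relI[OF g this order_refl]] Z x show ?thesis
    using Delta_run[of i i] i
    unfolding w_eq CC_eq[OF ab p(2)] RR_eq[OF ab p(2)] Delta_run[OF ab] by (auto simp: run_Cons)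
qed

end

section \<open>The monoid \<open>G\<^sup>+\<^sub>m\<^sub>,\<^sub>n\<close>\<close>

lemma pres_eq_cong: "pres_eq A R x y \<Longrightarrow> p \<in> lists A \<Longrightarrow> q \<in> lists A \<Longrightarrow> pres_eq A R (p @ x @ q) (p @ y @ q)"
proof (induction rule: pres_eq.induct)
  case (rel u v x y)
  then have "pres_eq A R ((p @ x) @ u @ (y @ q)) ((p @ x) @ v @ (y @ q))"
    by (intro pres_eq.rel) auto
  then show ?case by simp
next
  case (refl x)
  then show ?case by (intro pres_eq.refl) auto
qed (blast intro: pres_eq.sym pres_eq.trans)+

lemma pres_eq_UNIV: "pres_eq A R x y \<Longrightarrow> pres_eq UNIV R x y"
  by (induction rule: pres_eq.induct) (auto intro: pres_eq.intros)

text \<open>No relation leaves \<open>lists A\<close>, so neither does a chain of equalities that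
  starts there. The locale can therefore work over \<open>UNIV\<close>, and the alphabet is restored
  at the end.\<close>

lemma pres_eq_restrict:
  assumes "\<And>p q. (p, q) \<in> R \<Longrightarrow> p \<in> lists A \<and> q \<in> lists A"
  shows "pres_eq UNIV R x y \<Longrightarrow>
    (x \<in> lists A \<longleftrightarrow> y \<in> lists A) \<and> (x \<in> lists A \<longrightarrow> pres_eq A R x y)"
proof (induction rule: pres_eq.induct)
  case (rel p q x y)
  then show ?case using assms[OF rel(1)] by (auto intro: pres_eq.rel)
qed (auto intro: pres_eq.intros)

lemma rotate_S:
  assumes "1 \<le> k"
  shows "rotate j (S # run c 1 k) = S # run c 1 k
    \<or> (\<exists>i\<in>{1..k}. rotate j (S # run c 1 k) = run c i k @ S # lo c i)"
proof -
  let ?i = "j mod Suc k"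
  have len: "length (S # run c 1 k) = Suc k" by simp
  have rotate_eq: "rotate j (S # run c 1 k) = drop ?i (S # run c 1 k) @ take ?i (S # run c 1 k)"
    by (simp only: rotate_drop_take len)
  show ?thesis
  proof (cases "?i = 0")
    case True
    then show ?thesis using rotate_eq by simp
  next
    case False
    \<comment> \<open>Rotation by \<open>Suc i\<close> takes away \<open>S\<close> and
      \<open>i\<close> letters, so the remaining run starts at index \<open>Suc i\<close>.\<close>
    then obtain i where i: "?i = Suc i" by (cases ?i) auto
    then have "i < k" using mod_less_divisor[of "Suc k" j] by simp
    then have "run c 1 k = lo c (Suc i) @ run c (Suc i) k" "length (lo c (Suc i)) = i"
      using lo_run[of "Suc i" k c] lo_run[of 1 k c] by auto
    then have "rotate j (S # run c 1 k) = run c (Suc i) k @ S # lo c (Suc i)"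
      using rotate_eq i by simp
    then show ?thesis using \<open>i < k\<close> by (intro disjI2 bexI[of _ "Suc i"]) auto
  qed
qed

lemma rotate_pair: "rotate j [x, y] = [x, y] \<or> rotate j [x, y] = [y, x]"
  by (induction j) auto

lemma G_rels_cases:
  assumes "(p, q) \<in> G_rels m n" "1 \<le> m" "1 \<le> n"
  obtains "p = q"
  | i where "i \<in> {1..m}" "p = S # lo T (Suc m)" "q = run T i m @ S # lo T i"
  | i where "i \<in> {1..n}" "p = S # lo U (Suc n)" "q = run U i n @ S # lo U i"
  | i j where "i \<in> {1..m}" "j \<in> {1..n}" "p = [T i, U j]" "q = [U j, T i]"
proof -
  have lo: "lo c (Suc k) = run c 1 k" for c k by (simp add: lo_def)
  from assms consider j where "p = S # run T 1 m" "q = rotate j p"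
    | j where "p = S # run U 1 n" "q = rotate j p"
    | a b j where "a \<in> {1..m}" "b \<in> {1..n}" "p = [T a, U b]" "q = rotate j p"
    unfolding G_rels_def cyclic_rels_def by auto
  then show thesis
  proof cases
    case 1
    then show thesis using rotate_S[OF assms(2), of j T] that(1,2) lo by metis
  next
    case 2
    then show thesis using rotate_S[OF assms(3), of j U] that(1,3) lo by metis
  next
    case 3
    then show thesis using rotate_pair[of j] that(1,4) by metis
  qed
qed

lemma cyclic_rels_S:
  assumes "1 \<le> i" "i \<le> k"
  shows "(S # lo c (Suc k), run c i k @ S # lo c i) \<in> cyclic_rels (S # run c 1 k)"
proof -
  have len: "length (S # lo c i) = i" using assms by simp
  have "S # run c 1 k = (S # lo c i) @ run c i k" "lo c (Suc k) = run c 1 k"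
    using lo_run[of i k c] assms by (auto simp: lo_def)
  with rotate_append[of "S # lo c i" "run c i k"] len show ?thesis
    unfolding cyclic_rels_def by (metis (mono_tags, lifting) mem_Collect_eq)
qed

lemma G_rels_TU:
  assumes "1 \<le> i" "i \<le> m" "1 \<le> j" "j \<le> n" shows "([T i, U j], [U j, T i]) \<in> G_rels m n"
proof -
  have "[U j, T i] = rotate 1 [T i, U j]" by (simp add: One_nat_def)
  then have "([T i, U j], [U j, T i]) \<in> cyclic_rels [T i, U j]"
    unfolding cyclic_rels_def by blast
  with assms show ?thesis unfolding G_rels_def by force
qed

lemma pres_eq_rel: "(p, q) \<in> R \<Longrightarrow> pres_eq UNIV R p q"
  using pres_eq.rel[of p q R UNIV "[]" "[]"] by simp

lemma fan_G:
  assumes "2 \<le> m" "2 \<le> n"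
  shows "fan (pres_eq UNIV (G_rels m n)) T U m n"
proof
  fix x y assume "pres_eq UNIV (G_rels m n) x y"
  then show "length x = length y"
  proof (induction rule: pres_eq.induct)
    case (rel p q x y)
    have "length p = length q"
      using rel(1) unfolding G_rels_def cyclic_rels_def by auto
    then show ?case by simp
  qed auto
next
  fix i assume "1 \<le> i" "i \<le> m"
  then show "pres_eq UNIV (G_rels m n) (S # lo T (Suc m)) (run T i m @ S # lo T i)"
    unfolding G_rels_def by (intro pres_eq_rel UnI1 cyclic_rels_S)
next
  fix i assume "1 \<le> i" "i \<le> n"
  then show "pres_eq UNIV (G_rels m n) (S # lo U (Suc n)) (run U i n @ S # lo U i)"
    unfolding G_rels_def by (intro pres_eq_rel UnI1[OF UnI2] cyclic_rels_S)
qed (use assms in \<open>auto intro: pres_eq.refl pres_eq.sym pres_eq_cong pres_eq_rel[OF G_rels_TU] dest: pres_eq.trans\<close>)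

section \<open>The fan results for the relations of the monoid\<close>

context
  fixes m n :: nat
  assumes m: "2 \<le> m" and n: "2 \<le> n"
begin

interpretation fan "pres_eq UNIV (G_rels m n)" T U m n
  using fan_G m n .

lemma head_rel:
  assumes "(p, q) \<in> G_rels m n"
  shows "head_rel (p @ y) (q @ y)"
proof -
  have "1 \<le> m" "1 \<le> n" using m n by auto
  with assms show ?thesis
  proof (cases rule: G_rels_cases)
    case 1
    then show ?thesis using head_Nil head_same by (cases "q @ y") auto
  next
    case (2 i)
    then show ?thesis using head_Sc[OF 2(1), of "lo T (Suc m) @ y" y] by (simp add: run_Cons)
  next
    case (3 i)
    then show ?thesis using head_Sd[OF 3(1), of "lo U (Suc n) @ y" y] by (simp add: run_Cons)
  next
    case (4 i j)
    then show ?thesis using head_cd[OF 4(1,2), of "U j # y" y "T i # y"] by simp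
  qed
qed

text \<open>The outer induction is on the length, the inner one on the derivation of an equality. A
  relation applied behind a nonempty prefix is an instance of \<open>head_same\<close>; chains are
  handled by \<open>head_trans\<close>.\<close>

lemma head_rel_upto_all: "head_rel_upto N"
proof (induction N)
  case 0
  show ?case unfolding head_rel_upto_def using eq_length head_Nil by fastforce
next
  case (Suc N)
  have "length a \<le> Suc N \<longrightarrow> head_rel a b" if "pres_eq UNIV (G_rels m n) a b" for a b
    using that
  proof (induction rule: pres_eq.induct)
    case (rel p q x y)
    show ?case
    proof (cases x)
      case Nil
      then show ?thesis using head_rel[OF rel(1)] by simp
    next
      case (Cons v x')
      then show ?thesis using head_same[OF pres_eq.rel[OF rel(1)]] by simp
    qed
  next
    case (refl x)
    then show ?case using head_Nil head_same by (cases x) auto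
  next
    case (sym x y)
    then show ?case using head_sym eq_length by fastforce
  next
    case (trans x y z)
    then show ?case using head_trans[OF Suc, of y x z] eq_length[OF trans(1)] by simp
  qed
  then show ?case unfolding head_rel_upto_def by blast
qed

lemmas G_word_div =
  word_div_S[OF head_rel_upto_all] word_div_c[OF head_rel_upto_all]
  flip.word_div_S[unfolded head_rel_upto_flip, OF head_rel_upto_all] flip.word_div_c[unfolded head_rel_upto_flip, OF head_rel_upto_all]

lemma G_cancel: "pres_eq UNIV (G_rels m n) (v # X) (v # Y) \<Longrightarrow> pres_eq UNIV (G_rels m n) X Y"
  using head_same_D head_relI[OF head_rel_upto_all _ order_refl] by blast

lemma G_TU:
  "pres_eq UNIV (G_rels m n) (T i # X) (U j # Y) \<Longrightarrow>
    \<exists>Z. pres_eq UNIV (G_rels m n) X (U j # Z) \<and> pres_eq UNIV (G_rels m n) Y (T i # Z)"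
  using head_cd_D head_relI[OF head_rel_upto_all _ order_refl] by blast

end

lemma G_rels_lists:
  assumes "(p, q) \<in> G_rels m n"
  shows "p \<in> lists (L0 m n) \<and> q \<in> lists (L0 m n)"
  using assms unfolding G_rels_def cyclic_rels_def L0_def L1_def L2_def
  by (auto simp: run_def)

theorem proposition4p3:
  fixes m n r h :: nat and X Y Yh :: "gen list"
  assumes "m \<ge> 2" and "n \<ge> 2" and "h \<le> r"
    and "X \<in> lists (L0 m n)" and "length X = r"
    and "Y \<in> lists (L0 m n)" and "length Y = r"
    and "Yh \<in> lists (L0 m n)" and "length Yh = h"
  shows
    "(\<forall>v \<in> L0 m n. G_eq m n ([v] @ X) ([v] @ Y) \<longrightarrow> G_eq m n X Y)
   \<and> (\<forall>i \<in> {1..m}. \<forall>j \<in> {1..n}. G_eq m n ([T i] @ X) ([U j] @ Y) \<longrightarrow>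
        (\<exists>Z \<in> lists (L0 m n). G_eq m n X ([U j] @ Z) \<and> G_eq m n Y ([T i] @ Z)))
   \<and> (\<forall>w \<in> lists (L1 m). length w = r - h + 1 \<and> G_eq m n ([S] @ X) (w @ Yh) \<longrightarrow>
        (\<exists>Z \<in> lists (L0 m n).
           G_eq m n X (Delta T m [S] @ RR T m w @ Z) \<and>
           G_eq m n Yh (Delta T m (CC T m w) @ Z)))
   \<and> (\<forall>w \<in> lists (L2 n). length w = r - h + 1 \<and> G_eq m n ([S] @ X) (w @ Yh) \<longrightarrow>
        (\<exists>Z \<in> lists (L0 m n).
           G_eq m n X (Delta U n [S] @ RR U n w @ Z) \<and>
           G_eq m n Yh (Delta U n (CC U n w) @ Z)))
   \<and> (\<forall>i \<in> {1..m}. \<forall>w \<in> lists (L1 m). length w = r - h + 1 \<and> \<not> prefix [T i] w \<and>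
        G_eq m n ([T i] @ X) (w @ Yh) \<longrightarrow>
        (\<exists>x \<in> F2_rm n. \<exists>Z \<in> lists (L0 m n).
           G_eq m n X (x @ Delta T m [T i] @ RR T m w @ Z) \<and>
           G_eq m n Yh (x @ Delta T m (CC T m w) @ Z)))
   \<and> (\<forall>i \<in> {1..n}. \<forall>w \<in> lists (L2 n). length w = r - h + 1 \<and> \<not> prefix [U i] w \<and>
        G_eq m n ([U i] @ X) (w @ Yh) \<longrightarrow>
        (\<exists>x \<in> F1_rm m. \<exists>Z \<in> lists (L0 m n).
           G_eq m n X (x @ Delta U n [U i] @ RR U n w @ Z) \<and>
           G_eq m n Yh (x @ Delta U n (CC U n w) @ Z)))"
proof -
  have to: "pres_eq UNIV (G_rels m n) x y" if "G_eq m n x y" for x y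
    using that pres_eq_UNIV unfolding G_eq_def by blast
  \<comment> \<open>Equality stays inside \<open>lists (L0 m n)\<close>, so the right side lies
    there too; this yields the membership of the witness \<open>Z\<close>.\<close>
  have from_X: "G_eq m n X w \<and> w \<in> lists (L0 m n)" if "pres_eq UNIV (G_rels m n) X w" for w
    using pres_eq_restrict[OF G_rels_lists that] assms(4) unfolding G_eq_def by blast
  have from_Y: "G_eq m n Y w" if "pres_eq UNIV (G_rels m n) Y w" for w
    using pres_eq_restrict[OF G_rels_lists that] assms(6) unfolding G_eq_def by blast
  have from_Yh: "G_eq m n Yh w" if "pres_eq UNIV (G_rels m n) Yh w" for w
    using pres_eq_restrict[OF G_rels_lists that] assms(8) unfolding G_eq_def by blast
  have ne: "w \<noteq> []" if "length w = r - h + 1" for w :: "gen list" using that by auto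
  note div = G_word_div[OF assms(1,2)]
  show ?thesis
  proof (intro conjI ballI impI; (elim conjE)?)
    fix v assume "G_eq m n ([v] @ X) ([v] @ Y)"
    then show "G_eq m n X Y" using G_cancel[OF assms(1,2)] to from_X by fastforce
  next
    fix i j assume "G_eq m n ([T i] @ X) ([U j] @ Y)"
    from to[OF this] obtain Z where Z: "pres_eq UNIV (G_rels m n) X ([U j] @ Z)"
      "pres_eq UNIV (G_rels m n) Y ([T i] @ Z)"
      using G_TU[OF assms(1,2), of i X j Y] by auto
    from Z from_X[OF Z(1)] from_Y[OF Z(2)]
    show "\<exists>Z\<in>lists (L0 m n). G_eq m n X ([U j] @ Z) \<and> G_eq m n Y ([T i] @ Z)" by auto
  next
    fix w assume w: "w \<in> lists (L1 m)" "length w = r - h + 1" "G_eq m n ([S] @ X) (w @ Yh)"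
    from div(1)[of w X Yh] w ne to[OF w(3)] obtain Z where
      Z: "pres_eq UNIV (G_rels m n) X (Delta T m [S] @ RR T m w @ Z)"
      "pres_eq UNIV (G_rels m n) Yh (Delta T m (CC T m w) @ Z)" by (auto simp: L1_def)
    from from_X[OF Z(1)] from_Yh[OF Z(2)]
    show "\<exists>Z\<in>lists (L0 m n). G_eq m n X (Delta T m [S] @ RR T m w @ Z) \<and>
       G_eq m n Yh (Delta T m (CC T m w) @ Z)" by (metis append_in_lists_conv)
  next
    fix w assume w: "w \<in> lists (L2 n)" "length w = r - h + 1" "G_eq m n ([S] @ X) (w @ Yh)"
    from div(3)[of w X Yh] w ne to[OF w(3)] obtain Z where
      Z: "pres_eq UNIV (G_rels m n) X (Delta U n [S] @ RR U n w @ Z)"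
      "pres_eq UNIV (G_rels m n) Yh (Delta U n (CC U n w) @ Z)" by (auto simp: L2_def)
    from from_X[OF Z(1)] from_Yh[OF Z(2)]
    show "\<exists>Z\<in>lists (L0 m n). G_eq m n X (Delta U n [S] @ RR U n w @ Z) \<and>
       G_eq m n Yh (Delta U n (CC U n w) @ Z)" by (metis append_in_lists_conv)
  next
    fix i w assume w: "i \<in> {1..m}" "w \<in> lists (L1 m)" "length w = r - h + 1" "\<not> prefix [T i] w"
      "G_eq m n ([T i] @ X) (w @ Yh)"
    from div(2)[of w i X Yh] w ne to[OF w(5)] obtain x Z where
      x: "x \<in> F2_rm n" and Z: "pres_eq UNIV (G_rels m n) X (x @ Delta T m [T i] @ RR T m w @ Z)"
      "pres_eq UNIV (G_rels m n) Yh (x @ Delta T m (CC T m w) @ Z)"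
      unfolding L1_def L2_def F2_rm_def by auto
    from x from_X[OF Z(1)] from_Yh[OF Z(2)]
    show "\<exists>x\<in>F2_rm n. \<exists>Z\<in>lists (L0 m n). G_eq m n X (x @ Delta T m [T i] @ RR T m w @ Z) \<and>
       G_eq m n Yh (x @ Delta T m (CC T m w) @ Z)" by (metis append_in_lists_conv)
  next
    fix i w assume w: "i \<in> {1..n}" "w \<in> lists (L2 n)" "length w = r - h + 1" "\<not> prefix [U i] w"
      "G_eq m n ([U i] @ X) (w @ Yh)"
    from div(4)[of w i X Yh] w ne to[OF w(5)] obtain x Z where
      x: "x \<in> F1_rm m" and Z: "pres_eq UNIV (G_rels m n) X (x @ Delta U n [U i] @ RR U n w @ Z)"
      "pres_eq UNIV (G_rels m n) Yh (x @ Delta U n (CC U n w) @ Z)"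
      unfolding L1_def L2_def F1_rm_def by auto
    from x from_X[OF Z(1)] from_Yh[OF Z(2)]
    show "\<exists>x\<in>F1_rm m. \<exists>Z\<in>lists (L0 m n). G_eq m n X (x @ Delta U n [U i] @ RR U n w @ Z) \<and>
       G_eq m n Yh (x @ Delta U n (CC U n w) @ Z)" by (metis append_in_lists_conv)
  qed
qed

end
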